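(* Let $X_1,X_2$ be Banach spaces and let $X_1\times X_2$ be equipped with the norm $\|(x_1,x_2)\|=\sqrt{\|x_1\|^2+\|x_2\|^2}$. Let $A_{12}:D(A_{12})\subset X_2\to X_1$ and $A_{21}:D(A_{21})\subset X_1\to X_2$ be linear operators such that the operator $$A_{ext}=\begin{pmatrix}0 & A_{12} \\ A_{21} & 0\end{pmatrix},\qquad D(A_{ext})=\{(x_1,x_2)\in X_1\times X_2 : x_1\in D(A_{21}),\ x_2\in D(A_{12})\},$$ generates a contraction $C_0$-semigroup on $X_1\times X_2$. Let $S:X_2\to X_2$ be a bounded linear operator such that $$\mathcal{A}:=\begin{pmatrix}I & 0 \\ 0 & S\end{pmatrix}A_{ext},\qquad D(\mathcal{A})=D(A_{ext}),$$ generates a $C_0$-group on $X_1\times X_2$. Then the operator $$A_S=A_{12}SA_{21},\qquad D(A_S)=\{x\in X_1 : x\in D(A_{21}),\ SA_{21}x\in D(A_{12})\},$$ generates an analytic semigroup of angle $\frac{\pi}{2}$ on $X_1$.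
   Context: Banach spaces are over $\mathbb{C}$. A contraction $C_0$-semigroup is a strongly continuous semigroup $(T(t))_{t\ge0}$ of bounded linear operators with $\|T(t)\|\le1$ for all $t\ge0$. "Analytic semigroup of angle $\frac{\pi}{2}$" is meant in the usual sense (as in Engel–Nagel): the family $T(z)$ is defined for $z\in\Sigma_{\pi/2}\cup\{0\}$ with $\Sigma_{\pi/2}=\{z\in\mathbb{C}\setminus\{0\}:|\arg z|<\frac{\pi}{2}\}$, satisfies $T(0)=I$ and $T(z_1+z_2)=T(z_1)T(z_2)$ for all $z_1,z_2\in\Sigma_{\pi/2}$, is analytic on $\Sigma_{\pi/2}$, and $\lim_{z\to0,\ z\in\Sigma_{\delta'}}T(z)x=x$ for all $x$ and all $0<\delta'<\frac{\pi}{2}$; its generator is the generator of the $C_0$-semigroup $(T(t))_{t\ge0}$. *)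

theory Defs
  imports "HOL-Analysis.Analysis"
begin

section \<open>Complex Banach spaces\<close>

text \<open>
  The distribution only has real normed spaces as type classes. A complex one is a real one with
  a compatible complex scalar multiplication.
\<close>

class complex_vector = real_vector +
  fixes scaleC :: "complex \<Rightarrow> 'a \<Rightarrow> 'a"  (infixr "*\<^sub>C" 75)
  assumes scaleC_add_right: "c *\<^sub>C (x + y) = c *\<^sub>C x + c *\<^sub>C y"
    and scaleC_add_left: "(c + d) *\<^sub>C x = c *\<^sub>C x + d *\<^sub>C x"
    and scaleC_scaleC: "c *\<^sub>C d *\<^sub>C x = (c * d) *\<^sub>C x"
    and scaleC_of_real: "complex_of_real r *\<^sub>C x = r *\<^sub>R x"

class complex_normed_vector = complex_vector + real_normed_vector +
  assumes norm_scaleC: "norm (c *\<^sub>C x) = cmod c * norm x"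

class complex_banach = complex_normed_vector + complete_space

subclass (in complex_banach) banach ..

lemma scaleC_one: "1 *\<^sub>C x = (x :: 'a :: complex_vector)"
  using scaleC_of_real[of 1 x] by simp

global_interpretation complex_vector: vector_space "scaleC :: complex \<Rightarrow> 'a \<Rightarrow> 'a :: complex_vector"
  by unfold_locales (simp_all add: scaleC_add_right scaleC_add_left scaleC_scaleC scaleC_one)

text \<open>
  The norm on a product type is the one of \<^theory>\<open>HOL-Analysis.Product_Vector\<close>,
  the square root of the sum of the squared norms of the components (\<open>norm_Pair\<close>).
\<close>

instantiation prod :: (complex_vector, complex_vector) complex_vector
begin

definition scaleC_prod_def: "c *\<^sub>C p = (c *\<^sub>C fst p, c *\<^sub>C snd p)"

instance
  by standard
    (simp_all add: scaleC_prod_def prod_eq_iff scaleC_add_right scaleC_add_left scaleC_scaleC scaleC_of_real)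

end

instance prod :: (complex_normed_vector, complex_normed_vector) complex_normed_vector
proof
  fix c :: complex and p :: "'a \<times> 'b"
  have "(cmod c * norm (fst p))\<^sup>2 + (cmod c * norm (snd p))\<^sup>2
      = (cmod c)\<^sup>2 * ((norm (fst p))\<^sup>2 + (norm (snd p))\<^sup>2)"
    by (simp add: power_mult_distrib distrib_left)
  then show "norm (c *\<^sub>C p) = cmod c * norm p"
    by (simp add: scaleC_prod_def norm_prod_def norm_scaleC real_sqrt_mult)
qed

instance prod :: (complex_banach, complex_banach) complex_banach ..

section \<open>Linear operators\<close>

definition bounded_clinear :: "('a::complex_normed_vector \<Rightarrow> 'b::complex_normed_vector) \<Rightarrow> bool" where
  "bounded_clinear L \<longleftrightarrow> bounded_linear L \<and> (\<forall>c x. L (c *\<^sub>C x) = c *\<^sub>C L x)"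

text \<open>
  An unbounded operator is given by its domain \<open>D\<close> and a total function \<open>A\<close> whose values
  outside \<open>D\<close> are irrelevant.
\<close>

definition linear_operator :: "'a::complex_vector set \<Rightarrow> ('a \<Rightarrow> 'b::complex_vector) \<Rightarrow> bool" where
  "linear_operator D A \<longleftrightarrow> complex_vector.subspace D \<and>
     (\<forall>x\<in>D. \<forall>y\<in>D. A (x + y) = A x + A y) \<and> (\<forall>c. \<forall>x\<in>D. A (c *\<^sub>C x) = c *\<^sub>C A x)"

section \<open>Semigroups, groups and their generators\<close>

text \<open>Only the values \<open>T t\<close> for \<open>t \<ge> 0\<close> matter.\<close>

definition C0_semigroup :: "(real \<Rightarrow> 'a::complex_banach \<Rightarrow> 'a) \<Rightarrow> bool" where
  "C0_semigroup T \<longleftrightarrow>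
     (\<forall>t\<ge>0. bounded_clinear (T t)) \<and>
     T 0 = id \<and>
     (\<forall>s\<ge>0. \<forall>t\<ge>0. T (s + t) = T s \<circ> T t) \<and>
     (\<forall>x. continuous_on {0..} (\<lambda>t. T t x))"

definition contraction_C0_semigroup :: "(real \<Rightarrow> 'a::complex_banach \<Rightarrow> 'a) \<Rightarrow> bool" where
  "contraction_C0_semigroup T \<longleftrightarrow> C0_semigroup T \<and> (\<forall>t\<ge>0. onorm (T t) \<le> 1)"

definition C0_group :: "(real \<Rightarrow> 'a::complex_banach \<Rightarrow> 'a) \<Rightarrow> bool" where
  "C0_group T \<longleftrightarrow>
     (\<forall>t. bounded_clinear (T t)) \<and>
     T 0 = id \<and>
     (\<forall>s t. T (s + t) = T s \<circ> T t) \<and>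
     (\<forall>x. continuous_on UNIV (\<lambda>t. T t x))"

text \<open>
  \<open>generator_at F T D A\<close>: the operator \<open>A\<close> with domain \<open>D\<close> is the derivative of \<open>T\<close> at \<open>0\<close>
  along the filter \<open>F\<close>, and \<open>D\<close> is the set of all points where this derivative exists. The
  filter is \<open>at_right 0\<close> for semigroups and \<open>at 0\<close> for groups.
\<close>

definition generator_at ::
  "real filter \<Rightarrow> (real \<Rightarrow> 'a::complex_banach \<Rightarrow> 'a) \<Rightarrow> 'a set \<Rightarrow> ('a \<Rightarrow> 'a) \<Rightarrow> bool" where
  "generator_at F T D A \<longleftrightarrow>
     D = {x. \<exists>y. ((\<lambda>h. (1 / h) *\<^sub>R (T h x - x)) \<longlongrightarrow> y) F} \<and>
     (\<forall>x\<in>D. ((\<lambda>h. (1 / h) *\<^sub>R (T h x - x)) \<longlongrightarrow> A x) F)"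

definition generates_contraction_C0_semigroup :: "'a::complex_banach set \<Rightarrow> ('a \<Rightarrow> 'a) \<Rightarrow> bool" where
  "generates_contraction_C0_semigroup D A \<longleftrightarrow>
     (\<exists>T. contraction_C0_semigroup T \<and> generator_at (at_right 0) T D A)"

definition generates_C0_group :: "'a::complex_banach set \<Rightarrow> ('a \<Rightarrow> 'a) \<Rightarrow> bool" where
  "generates_C0_group D A \<longleftrightarrow> (\<exists>T. C0_group T \<and> generator_at (at 0) T D A)"

section \<open>Analytic semigroups\<close>

definition sector :: "real \<Rightarrow> complex set" where
  "sector \<delta> = {z. z \<noteq> 0 \<and> \<bar>Arg z\<bar> < \<delta>}"

text \<open>
  Analyticity on an open set is complex differentiability with respect to the operator norm,
  the derivative \<open>L\<close> at \<open>z\<close> being a bounded complex linear operator. The use of \<open>onorm\<close>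
  presupposes that \<open>T w\<close> is bounded for \<open>w \<in> U\<close>, as required in the definition below.
\<close>

definition operator_analytic_on ::
  "(complex \<Rightarrow> 'a::complex_normed_vector \<Rightarrow> 'b::complex_normed_vector) \<Rightarrow> complex set \<Rightarrow> bool" where
  "operator_analytic_on T U \<longleftrightarrow>
     (\<forall>z\<in>U. \<exists>L. bounded_clinear L \<and>
        ((\<lambda>w. onorm (\<lambda>x. (1 / (w - z)) *\<^sub>C (T w x - T z x) - L x)) \<longlongrightarrow> 0) (at z))"

text \<open>Only the values \<open>T z\<close> for \<open>z\<close> in the sector or \<open>z = 0\<close> matter.\<close>

definition analytic_semigroup :: "real \<Rightarrow> (complex \<Rightarrow> 'a::complex_banach \<Rightarrow> 'a) \<Rightarrow> bool" where
  "analytic_semigroup \<delta> T \<longleftrightarrow>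
     (\<forall>z \<in> sector \<delta> \<union> {0}. bounded_clinear (T z)) \<and>
     T 0 = id \<and>
     (\<forall>z \<in> sector \<delta>. \<forall>w \<in> sector \<delta>. T (z + w) = T z \<circ> T w) \<and>
     operator_analytic_on T (sector \<delta>) \<and>
     (\<forall>\<delta>'. 0 < \<delta>' \<and> \<delta>' < \<delta> \<longrightarrow> (\<forall>x. ((\<lambda>z. T z x) \<longlongrightarrow> x) (at 0 within sector \<delta>')))"

definition generates_analytic_semigroup ::
  "real \<Rightarrow> 'a::complex_banach set \<Rightarrow> ('a \<Rightarrow> 'a) \<Rightarrow> bool" where
  "generates_analytic_semigroup \<delta> D A \<longleftrightarrow>
     (\<exists>T. analytic_semigroup \<delta> T \<and> generator_at (at_right 0) (\<lambda>t. T (complex_of_real t)) D A)"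

section \<open>The block operators\<close>

definition A_ext :: "('b \<Rightarrow> 'a) \<Rightarrow> ('a \<Rightarrow> 'b) \<Rightarrow> 'a \<times> 'b \<Rightarrow> 'a \<times> 'b" where
  "A_ext A12 A21 = (\<lambda>(x1, x2). (A12 x2, A21 x1))"

definition diag_I :: "('b \<Rightarrow> 'b) \<Rightarrow> 'a \<times> 'b \<Rightarrow> 'a \<times> 'b" where
  "diag_I S = (\<lambda>(x1, x2). (x1, S x2))"

end

theory Submission
  imports Defs "HOL-Complex_Analysis.Complex_Analysis" "HOL-Probability.Distributions"
begin

text \<open>
  The operator \<open>B = diag(I, S) A_ext\<close> generates a group \<open>U\<close>, and the operator of the theorem is the
  part of \<open>B\<^sup>2\<close> in the first factor. The square of a group generator generates the analytic
  semigroup of angle \<open>\<pi>/2\<close> given by the Gaussian average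
  \<open>T(z) x = (4\<pi>z)\<^sup>-\<^sup>1\<^sup>/\<^sup>2 \<integral> exp(-s\<^sup>2/(4z)) U(s) x ds\<close>, because the kernel solves the heat equation
  in \<open>z\<close> and \<open>s\<close>, while \<open>B\<close> acts on such averages by differentiating the kernel. Finally, the
  reflection \<open>(x\<^sub>1, x\<^sub>2) \<mapsto> (x\<^sub>1, -x\<^sub>2)\<close> anticommutes with \<open>B\<close>, hence intertwines \<open>U(t)\<close> and \<open>U(-t)\<close>;
  as the kernel is even, \<open>T(z)\<close> commutes with the reflection and leaves the first factor invariant.
\<close>

section \<open>Complex linear maps and uniform boundedness\<close>

text \<open>Differentiation replaces computation with Gaussian integrals. Neither the semigroup law
  nor the total mass of the kernel at complex times is obtained by convolution, an exchange of
  integrals or a contour shift: in both cases a function built from bounded operators has derivative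
  zero. The kernel estimates therefore aim at differentiability in operator norm.

  Half of identifying the generator is to show that a right derivative at zero forces
  \<open>x\<close> into the domain of the squared operator. At positive times smoothing puts the
  average into that domain; to let the time tend to zero the square must be closed, and in general
  closedness of an operator does not pass to its square. An interpolation inequality that controls
  the middle term fills this gap.

  Anticommutation with the reflection is visible only for the generator. Carrying it to the group
  takes uniqueness of a group with a given generator, and the density of the domain that this needs
  is supplied by the averages themselves.\<close>

lemma scaleC_scaleR: "c *\<^sub>C r *\<^sub>R x = r *\<^sub>R c *\<^sub>C (x :: 'a :: complex_vector)"
  by (simp add: scaleC_scaleC mult.commute flip: scaleC_of_real)

lemma bounded_bilinear_scaleC:
  "bounded_bilinear (scaleC :: complex \<Rightarrow> 'a \<Rightarrow> 'a::complex_normed_vector)"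
proof
  fix r :: real and c :: complex and x :: 'a
  show "(r *\<^sub>R c) *\<^sub>C x = r *\<^sub>R c *\<^sub>C x"
    by (simp add: scaleR_conv_of_real scaleC_scaleC flip: scaleC_of_real)
  show "\<exists>K. \<forall>c x. norm (c *\<^sub>C (x::'a)) \<le> norm c * norm x * K"
    by (rule exI[of _ 1]) (simp add: norm_scaleC)
qed (simp_all add: scaleC_add_left scaleC_add_right scaleC_scaleR)

lemmas continuous_on_scaleC [continuous_intros] =
  bounded_bilinear.continuous_on[OF bounded_bilinear_scaleC]

lemma bounded_clinear_linear: "bounded_clinear L \<Longrightarrow> bounded_linear L"
  by (simp add: bounded_clinear_def)

lemma bounded_clinear_scaleC: "bounded_clinear L \<Longrightarrow> L (c *\<^sub>C x) = c *\<^sub>C L x"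
  by (simp add: bounded_clinear_def)

lemma bounded_clinear_scaleC_right: "bounded_clinear ((*\<^sub>C) c)"
  unfolding bounded_clinear_def
  using bounded_bilinear.bounded_linear_right[OF bounded_bilinear_scaleC, of c]
  by (simp add: scaleC_scaleC mult.commute)

text \<open>Baire category: the closed sets \<open>E n\<close> cover a complete space, so one of
  them contains a ball, and differences of points of that ball reach every direction.\<close>

theorem uniform_boundedness:
  fixes F :: "'i \<Rightarrow> 'a::banach \<Rightarrow> 'b::real_normed_vector"
  assumes lin: "\<And>i. i \<in> I \<Longrightarrow> bounded_linear (F i)"
    and bdd: "\<And>x. \<exists>c. \<forall>i\<in>I. norm (F i x) \<le> c"
  obtains c where "c \<ge> 0" "\<And>i x. i \<in> I \<Longrightarrow> norm (F i x) \<le> c * norm x"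
proof -
  define E where "E n = (\<Inter>i\<in>I. {x. norm (F i x) \<le> real n})" for n
  have cl: "closed (E n)" for n
    unfolding E_def
    by (intro closed_INT ballI closed_Collect_le continuous_intros
        linear_continuous_on[OF lin]) auto
  have "\<Union>(range E) = UNIV"
  proof -
    have "\<exists>n. x \<in> E n" for x
    proof -
      obtain c where "\<forall>i\<in>I. norm (F i x) \<le> c" using bdd by blast
      moreover obtain n where "c \<le> real n" using real_arch_simple by blast
      ultimately have "x \<in> E n" unfolding E_def by auto
      then show ?thesis ..
    qed
    then show ?thesis by auto
  qed
  moreover have "interior (\<Union>(range E)) = {}" if "\<And>n. interior (E n) = {}"
    using Met_TC.metric_Baire_category_alt[where ?'a = 'a, of "range E"] cl that
    by (simp add: complete_UNIV image_iff) blast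
  ultimately have "\<exists>n. interior (E n) \<noteq> {}"
    by fastforce
  then obtain n x0 where "x0 \<in> interior (E n)" by auto
  then obtain r where r: "r > 0" "ball x0 r \<subseteq> E n"
    by (auto simp: mem_interior)
  have "norm (F i x) \<le> (4 * real n / r) * norm x" if i: "i \<in> I" for i x
  proof (cases "x = 0")
    case True
    then show ?thesis using linear_0[OF bounded_linear.linear[OF lin[OF i]]] by simp
  next
    case False
    interpret bounded_linear "F i" using lin[OF i] .
    \<comment> \<open>This factor moves the centre by exactly \<open>r / 2\<close>, so both
      \<open>x0\<close> and the moved point stay in the ball.\<close>
    define q where "q = r / (2 * norm x)"
    have q: "q > 0" using False r by (simp add: q_def)
    have "x0 + q *\<^sub>R x \<in> ball x0 r" "x0 \<in> ball x0 r"
      using False r by (simp_all add: dist_norm q_def)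
    then have "norm (F i (x0 + q *\<^sub>R x)) \<le> n" "norm (F i x0) \<le> n"
      using r i unfolding E_def by blast+
    moreover have "norm (F i (q *\<^sub>R x)) \<le> norm (F i (x0 + q *\<^sub>R x)) + norm (F i x0)"
      by (simp add: add) (metis add_diff_cancel_left' norm_triangle_ineq4 scaleR)
    ultimately have "q * norm (F i x) \<le> 2 * n" using q by (simp add: scaleR)
    then have "norm (F i x) \<le> 2 * n / q" using q by (simp add: field_simps)
    also have "\<dots> = (4 * real n / r) * norm x" using False r by (simp add: q_def field_simps)
    finally show ?thesis .
  qed
  then show thesis using that[of "4 * real n / r"] r by simp
qed

section \<open>Integrals over the real line\<close>

text \<open>
  Integrals of vector-valued functions are Henstock-Kurzweil integrals: the Bochner integral of the
  library requires a second countable target, which a Banach space need not be.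
\<close>

lemma has_integral_UNIV_translate:
  fixes f :: "real \<Rightarrow> 'a::real_normed_vector"
  assumes "(f has_integral i) UNIV"
  shows "((\<lambda>x. f (c + x)) has_integral i) UNIV"
proof (subst has_integral_alt, clarsimp)
  fix e :: real assume "e > 0"
  have "\<not> (\<exists>a b. (UNIV :: real set) = cbox a b)"
    by (metis bounded_cbox not_bounded_UNIV)
  from has_integral_altD[OF assms this \<open>e > 0\<close>] obtain B where B: "B > 0"
    "\<And>a b. ball (0::real) B \<subseteq> cbox a b \<Longrightarrow> \<exists>z. (f has_integral z) (cbox a b) \<and> norm (z - i) < e"
    by auto
  show "\<exists>B>0. \<forall>a b. ball 0 B \<subseteq> {a..b} \<longrightarrow>
      (\<exists>z. ((\<lambda>x. f (c + x)) has_integral z) {a..b} \<and> norm (z - i) < e)"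
  proof (intro exI[of _ "B + \<bar>c\<bar>"] conjI allI impI)
    fix a b :: real assume ab: "ball 0 (B + \<bar>c\<bar>) \<subseteq> {a..b}"
    have "ball (0::real) B \<subseteq> cbox (a + c) (b + c)"
    proof
      fix x assume "x \<in> ball (0::real) B"
      then have "x - c \<in> ball 0 (B + \<bar>c\<bar>)" by (auto simp: dist_real_def)
      then show "x \<in> cbox (a + c) (b + c)" using ab by fastforce
    qed
    from B(2)[OF this] show "\<exists>z. ((\<lambda>x. f (c + x)) has_integral z) {a..b} \<and> norm (z - i) < e"
      using has_integral_shift_Icc_real[of f c _ a b] by (auto simp: o_def)
  qed (use B in auto)
qed

lemma has_integral_UNIV_reflect:
  fixes f :: "real \<Rightarrow> 'a::real_normed_vector"
  assumes "(f has_integral i) UNIV"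
  shows "((\<lambda>x. f (- x)) has_integral i) UNIV"
proof (subst has_integral_alt, clarsimp)
  fix e :: real assume "e > 0"
  have "\<not> (\<exists>a b. (UNIV :: real set) = cbox a b)"
    by (metis bounded_cbox not_bounded_UNIV)
  from has_integral_altD[OF assms this \<open>e > 0\<close>] obtain B where B: "B > 0"
    "\<And>a b. ball (0::real) B \<subseteq> cbox a b \<Longrightarrow> \<exists>z. (f has_integral z) (cbox a b) \<and> norm (z - i) < e"
    by auto
  show "\<exists>B>0. \<forall>a b. ball 0 B \<subseteq> {a..b} \<longrightarrow>
      (\<exists>z. ((\<lambda>x. f (- x)) has_integral z) {a..b} \<and> norm (z - i) < e)"
  proof (intro exI[of _ B] conjI allI impI)
    fix a b :: real assume ab: "ball 0 B \<subseteq> {a..b}"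
    have "ball (0::real) B \<subseteq> cbox (- b) (- a)"
    proof
      fix x assume "x \<in> ball (0::real) B"
      then have "- x \<in> ball 0 B" by (auto simp: dist_real_def)
      then show "x \<in> cbox (- b) (- a)" using ab by fastforce
    qed
    from B(2)[OF this] show "\<exists>z. ((\<lambda>x. f (- x)) has_integral z) {a..b} \<and> norm (z - i) < e"
      using has_integral_reflect_lemma_real[of f _ "-b" "-a"] by auto
  qed (use B in auto)
qed

lemma has_integral_exp_minus_abs:
  assumes "a > 0"
  shows "((\<lambda>s::real. exp (- (a * \<bar>s\<bar>))) has_integral 2 / a) UNIV"
proof -
  have pos: "((\<lambda>s. exp (- (a * \<bar>s\<bar>))) has_integral 1 / a) {0..}"
    using has_integral_exp_minus_to_infinity[OF assms, of 0]
    by (rule has_integral_eq_rhs[OF has_integral_eq[rotated]]) auto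
  then have "((\<lambda>s. if s \<in> {0..} then exp (- (a * \<bar>s\<bar>)) else 0) has_integral 1 / a) UNIV"
    by (simp only: has_integral_restrict_UNIV)
  from has_integral_UNIV_reflect[OF this]
  have "((\<lambda>s. if s \<in> {..0} then exp (- (a * \<bar>s\<bar>)) else 0) has_integral 1 / a) UNIV"
    by (rule has_integral_eq[rotated]) auto
  then have "((\<lambda>s. exp (- (a * \<bar>s\<bar>))) has_integral 1 / a) {..0}"
    by (simp only: has_integral_restrict_UNIV)
  moreover have "{0..} \<inter> {..0} = {0::real}" by auto
  ultimately have
    "((\<lambda>s. exp (- (a * \<bar>s\<bar>))) has_integral (1 / a + 1 / a)) ({0..} \<union> {..0})"
    by (intro has_integral_Un[OF pos]) auto
  moreover have "{0..} \<union> {..0} = (UNIV :: real set)" by auto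
  ultimately show ?thesis by simp
qed

text \<open>The convergence criterion behind the averages below: continuity handles compact
  intervals, and a two-sided exponential of mass \<open>2 / a\<close> dominates at infinity.\<close>

lemma exp_decay_dominated:
  fixes f :: "real \<Rightarrow> 'a::banach"
  assumes "a > 0" "continuous_on UNIV f" "\<And>s. norm (f s) \<le> c * exp (- (a * \<bar>s\<bar>))"
  shows exp_decay_integrable: "f integrable_on UNIV"
    and exp_decay_integral_bound: "norm (integral UNIV f) \<le> 2 * c / a"
proof -
  have g: "((\<lambda>s. c * exp (- (a * \<bar>s\<bar>))) has_integral (c * (2 / a))) UNIV"
    by (intro has_integral_mult_right has_integral_exp_minus_abs assms)
  show f: "f integrable_on UNIV"
    by (rule integrable_on_all_intervals_UNIV[OF _ assms(3)])
      (use g in \<open>auto intro!: integrable_continuous_interval continuous_on_subset[OF assms(2)]\<close>)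
  show "norm (integral UNIV f) \<le> 2 * c / a"
    using integral_norm_bound_integral[OF f _ assms(3)] g
    by (auto simp: has_integral_iff mult.commute)
qed

section \<open>Groups with an exponential bound\<close>

text \<open>Growth is measured in \<open>\<bar>t\<bar>\<close>, so that one bound serves both time
  directions. The normalisations of \<open>\<omega>\<close> and \<open>M\<close> make the bound
  increasing in \<open>\<bar>t\<bar>\<close> and at least \<open>norm x\<close>.\<close>

locale C0_group_bounded =
  fixes U :: "real \<Rightarrow> 'a::complex_banach \<Rightarrow> 'a" and M \<omega> :: real
  assumes clinear: "bounded_clinear (U t)"
    and zero [simp]: "U 0 x = x"
    and add: "U (s + t) x = U s (U t x)"
    and cont: "continuous_on UNIV (\<lambda>t. U t x)"
    and bound: "norm (U t x) \<le> M * exp (\<omega> * \<bar>t\<bar>) * norm x"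
    and omega_nonneg: "\<omega> \<ge> 0" and M_ge_1: "M \<ge> 1"

text \<open>Orbits are bounded on the compact interval from -1 to 1, hence so are the operators; the
  group law spreads this bound over the line at an exponential price.\<close>

lemma C0_group_bounded_exists:
  assumes "C0_group U"
  shows "\<exists>M \<omega>. C0_group_bounded U M \<omega>"
proof -
  have lin: "bounded_clinear (U t)" and add: "U (s + t) = U s \<circ> U t"
    and zero: "U 0 = id" and cont: "continuous_on UNIV (\<lambda>t. U t x)" for s t x
    using assms by (auto simp: C0_group_def)
  have "\<exists>c. \<forall>t\<in>{-1..1}. norm (U t x) \<le> c" for x
    using compact_imp_bounded[OF compact_continuous_image[OF
        continuous_on_subset[OF cont[of x], of "{-1..1}"]]]
    by (auto simp: bounded_iff)
  then obtain c where c: "c \<ge> 0" "\<And>t x. t \<in> {-1..1} \<Longrightarrow> norm (U t x) \<le> c * norm x"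
    using uniform_boundedness[of "{-1..1}" U] bounded_clinear_linear[OF lin] by blast
  define M where "M = max c 1"
  have M: "M \<ge> 1" by (simp add: M_def)
  have unit: "norm (U t x) \<le> M * norm x" if "\<bar>t\<bar> \<le> 1" for t x
    using c(2)[of t x] that by (smt (verit) M_def atLeastAtMost_iff mult_right_mono norm_ge_zero)
  have mult: "norm (U (real m * t) x) \<le> M ^ m * norm x" if "\<bar>t\<bar> \<le> 1" for m t x
  proof (induction m)
    case (Suc m)
    have "U (real (Suc m) * t) x = U t (U (real m * t) x)"
      using add[of t "real m * t"] by (simp add: algebra_simps)
    then have "norm (U (real (Suc m) * t) x) \<le> M * norm (U (real m * t) x)"
      using unit[OF that] by simp
    also have "\<dots> \<le> M * (M ^ m * norm x)" using Suc M by (intro mult_left_mono) auto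
    finally show ?case by (simp add: mult_ac)
  qed (simp add: zero)
  have "norm (U t x) \<le> M * exp (ln M * \<bar>t\<bar>) * norm x" for t x
  proof -
    \<comment> \<open>The successor keeps \<open>m\<close> positive even for \<open>t = 0\<close>.
      Then \<open>t / m\<close> has modulus at most one, while \<open>m\<close> exceeds
      \<open>\<bar>t\<bar>\<close> by at most one, which costs the single factor
      \<open>M\<close>.\<close>
    define m where "m = Suc (nat \<lfloor>\<bar>t\<bar>\<rfloor>)"
    have m: "\<bar>t\<bar> \<le> real m" "real m \<le> \<bar>t\<bar> + 1" "m > 0" by (auto simp: m_def) linarith
    have "norm (U (real m * (t / real m)) x) \<le> M ^ m * norm x"
      using m by (intro mult) (simp add: field_simps)
    then have "norm (U t x) \<le> M ^ m * norm x" using m by simp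
    also have "M ^ m = M powr real m" using M by (simp add: powr_realpow)
    also have "M powr real m \<le> M powr (\<bar>t\<bar> + 1)" using m M by (intro powr_mono) auto
    also have "M powr (\<bar>t\<bar> + 1) = M * exp (ln M * \<bar>t\<bar>)"
      using M by (simp add: powr_add) (simp add: powr_def mult.commute)
    finally show ?thesis by (auto simp: mult_right_mono)
  qed
  then have "C0_group_bounded U M (ln M)"
    using lin add zero cont M by unfold_locales auto
  then show ?thesis by blast
qed

context C0_group_bounded
begin

lemma linear_U: "bounded_linear (U t)"
  by (rule bounded_clinear_linear[OF clinear])

lemmas U_diff = linear_diff[OF bounded_linear.linear[OF linear_U]]
  and U_plus = linear_add[OF bounded_linear.linear[OF linear_U]]
  and U_uminus = linear_neg[OF bounded_linear.linear[OF linear_U]]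

text \<open>A relation instead of a partial function: one statement expresses both membership of
  \<open>x\<close> in the domain and the value \<open>y\<close>.\<close>

definition gen :: "'a \<Rightarrow> 'a \<Rightarrow> bool" where
  "gen x y \<longleftrightarrow> ((\<lambda>h. (1 / h) *\<^sub>R (U h x - x)) \<longlongrightarrow> y) (at 0)"

lemma gen_unique: "gen x y \<Longrightarrow> gen x z \<Longrightarrow> y = z"
  unfolding gen_def by (rule tendsto_unique[rotated]) auto

lemma gen_commuting:
  assumes "bounded_linear L" "\<And>t x. L (U t x) = U t (L x)" "gen x y"
  shows "gen (L x) (L y)"
proof -
  interpret bounded_linear L by fact
  show ?thesis
    using tendsto[OF assms(3)[unfolded gen_def]] unfolding gen_def
    by (simp add: scaleR diff assms(2))
qed

lemma U_commute: "U s (U t x) = U t (U s x)"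
  by (metis add add.commute)

lemma gen_U: "gen x y \<Longrightarrow> gen (U t x) (U t y)"
  by (rule gen_commuting[OF linear_U U_commute])

lemma gen_diff: "gen x y \<Longrightarrow> gen x' y' \<Longrightarrow> gen (x - x') (y - y')"
  unfolding gen_def
  by (drule (1) tendsto_diff) (simp add: U_diff scaleR_diff_right algebra_simps)

lemma gen_has_vector_derivative:
  assumes "gen x y"
  shows "((\<lambda>t. U t x) has_vector_derivative U t y) (at t)"
proof -
  have "((\<lambda>h. (1 / h) *\<^sub>R (U h (U t x) - U t x)) \<longlongrightarrow> U t y) (at 0)"
    using gen_U[OF assms] by (simp add: gen_def)
  then have "((\<lambda>h. norm ((1 / h) *\<^sub>R (U h (U t x) - U t x) - U t y)) \<longlongrightarrow> 0) (at 0)"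
    by (intro tendsto_norm_zero LIM_zero)
  then have "((\<lambda>h. norm (U (t + h) x - U t x - h *\<^sub>R U t y) / norm h) \<longlongrightarrow> 0) (at 0)"
  proof (rule Lim_transform_eventually)
    have "norm ((1 / h) *\<^sub>R (U h (U t x) - U t x) - U t y)
        = norm (U (t + h) x - U t x - h *\<^sub>R U t y) / norm h" if "h \<noteq> 0" for h
    proof -
      have "(1 / h) *\<^sub>R (U h (U t x) - U t x) - U t y = (1 / h) *\<^sub>R (U (t + h) x - U t x - h *\<^sub>R U t y)"
        using that by (simp add: scaleR_diff_right add.commute[of t] add)
      then show ?thesis by simp
    qed
    then show "\<forall>\<^sub>F h in at 0. norm ((1 / h) *\<^sub>R (U h (U t x) - U t x) - U t y)
        = norm (U (t + h) x - U t x - h *\<^sub>R U t y) / norm h"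
      unfolding eventually_at_filter by (intro always_eventually) blast
  qed
  then show ?thesis
    unfolding has_vector_derivative_def
    by (intro has_derivative_at[THEN iffD2] conjI bounded_linear_scaleR_left)
qed

text \<open>Plays the part of writing \<open>U t u - u\<close> as the integral of
  \<open>U s v\<close>: the function \<open>U s u - s w\<close> has derivative
  \<open>U s v - w\<close>. The free vector \<open>w\<close> allows comparison with a limit or with
  zero.\<close>

lemma gen_mean_value:
  assumes "gen u v" "\<And>s. \<bar>s\<bar> \<le> \<bar>t\<bar> \<Longrightarrow> norm (U s v - w) \<le> e"
  shows "norm (U t u - u - t *\<^sub>R w) \<le> \<bar>t\<bar> * e"
proof -
  have "norm ((U t u - t *\<^sub>R w) - (U 0 u - 0 *\<^sub>R w)) \<le> e * norm (t - 0)"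
  proof (rule differentiable_bound)
    fix s assume s: "s \<in> {- \<bar>t\<bar>..\<bar>t\<bar>}"
    show "((\<lambda>s. U s u - s *\<^sub>R w) has_derivative (\<lambda>h. h *\<^sub>R (U s v - w))) (at s within {- \<bar>t\<bar>..\<bar>t\<bar>})"
    proof -
      have "((\<lambda>s. s *\<^sub>R w) has_vector_derivative w) (at s)"
        unfolding has_vector_derivative_def
        by (rule bounded_linear_imp_has_derivative[OF bounded_linear_scaleR_left])
      from has_vector_derivative_diff[OF gen_has_vector_derivative[OF assms(1), of s] this]
      show ?thesis unfolding has_vector_derivative_def by (rule has_derivative_at_withinI)
    qed
    show "onorm (\<lambda>h. h *\<^sub>R (U s v - w)) \<le> e"
    proof (rule onorm_le)
      have "norm (U s v - w) \<le> e" by (rule assms(2)) (use s in auto)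
      then show "norm (h *\<^sub>R (U s v - w)) \<le> e * norm h" for h
        by (simp add: mult.commute[of e] mult_left_mono)
    qed
  qed auto
  then show ?thesis by (simp add: algebra_simps)
qed

lemma U_uniform_bound: "\<bar>s\<bar> \<le> 1 \<Longrightarrow> norm (U s x) \<le> M * exp \<omega> * norm x"
proof -
  assume "\<bar>s\<bar> \<le> 1"
  then have "exp (\<omega> * \<bar>s\<bar>) \<le> exp \<omega>" using omega_nonneg by (simp add: mult_left_le)
  then have "M * exp (\<omega> * \<bar>s\<bar>) * norm x \<le> M * exp \<omega> * norm x"
    using M_ge_1 by (intro mult_right_mono mult_left_mono) auto
  then show ?thesis using bound[of s x] by linarith
qed

lemma U_near: "e > 0 \<Longrightarrow> \<exists>d>0. \<forall>s. \<bar>s\<bar> < d \<longrightarrow> norm (U s x - x) < e"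
  using cont[of x, unfolded continuous_on_iff, rule_format, of 0 e] by (simp add: dist_norm)

text \<open>For fixed small \<open>t\<close> the mean value estimate holds for all large
  \<open>n\<close>, so it survives the limit in \<open>n\<close>; only afterwards is it divided by
  \<open>t\<close>.\<close>

lemma gen_closed:
  assumes "\<And>n. gen (x n) (y n)" "x \<longlonglongrightarrow> a" "y \<longlonglongrightarrow> b"
  shows "gen a b"
  unfolding gen_def
proof (rule tendstoI)
  fix e :: real assume e: "e > 0"
  obtain d where d: "d > 0" "\<And>s. \<bar>s\<bar> < d \<Longrightarrow> norm (U s b - b) < e / 4"
    using U_near[of "e/4" b] e by auto
  have est: "norm (U t a - a - t *\<^sub>R b) \<le> \<bar>t\<bar> * (e / 2)" if t: "\<bar>t\<bar> < min d 1" for t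
  proof (rule tendsto_upperbound)
    show "(\<lambda>n. norm (U t (x n) - x n - t *\<^sub>R b)) \<longlonglongrightarrow> norm (U t a - a - t *\<^sub>R b)"
      by (intro tendsto_intros bounded_linear.tendsto[OF linear_U] assms)
    have "(\<lambda>n. M * exp \<omega> * norm (y n - b)) \<longlonglongrightarrow> M * exp \<omega> * norm (b - b)"
      by (intro tendsto_intros assms)
    then have "\<forall>\<^sub>F n in sequentially. M * exp \<omega> * norm (y n - b) < e / 4"
      using e by (intro order_tendstoD) auto
    then show "\<forall>\<^sub>F n in sequentially. norm (U t (x n) - x n - t *\<^sub>R b) \<le> \<bar>t\<bar> * (e / 2)"
    proof eventually_elim
      case (elim n)
      show ?case
      proof (rule gen_mean_value[OF assms(1)])
        fix s :: real assume s: "\<bar>s\<bar> \<le> \<bar>t\<bar>"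
        have "U s (y n) - b = U s (y n - b) + (U s b - b)" by (simp add: U_diff)
        then have "norm (U s (y n) - b) \<le> norm (U s (y n - b)) + norm (U s b - b)"
          by (metis norm_triangle_ineq)
        then show "norm (U s (y n) - b) \<le> e / 2"
          using U_uniform_bound[of s "y n - b"] d(2)[of s] elim s t by linarith
      qed
    qed
  qed auto
  show "\<forall>\<^sub>F h in at 0. dist ((1 / h) *\<^sub>R (U h a - a)) b < e"
    unfolding eventually_at
  proof (intro exI[of _ "min d 1"] conjI ballI impI)
    fix h :: real assume h: "h \<noteq> 0 \<and> dist h 0 < min d 1"
    have "(1 / h) *\<^sub>R (U h a - a) - b = (1 / h) *\<^sub>R (U h a - a - h *\<^sub>R b)"
      using h by (simp add: scaleR_diff_right)
    then have "norm ((1 / h) *\<^sub>R (U h a - a) - b) = norm (U h a - a - h *\<^sub>R b) / \<bar>h\<bar>"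
      by simp
    also have "\<dots> \<le> e / 2" using est[of h] h by (simp add: field_simps)
    finally show "dist ((1 / h) *\<^sub>R (U h a - a)) b < e" using e by (simp add: dist_norm)
  qed (use d in auto)
qed

text \<open>A Landau-Kolmogorov type inequality: \<open>U 1 x\<close> is \<open>x + a\<close> up to
  a remainder controlled by the second derivative \<open>y\<close>, so \<open>a\<close> is
  controlled by \<open>x\<close> and \<open>y\<close>.\<close>

lemma gen_interpolation:
  assumes "gen x a" "gen a y"
  shows "norm a \<le> (M * exp \<omega> + 1) * norm x + M * exp \<omega> * norm y"
proof -
  have near: "norm (U s a - a) \<le> M * exp \<omega> * norm y" if "\<bar>s\<bar> \<le> 1" for s
  proof -
    have "norm (U s a - a - s *\<^sub>R 0) \<le> \<bar>s\<bar> * (M * exp \<omega> * norm y)"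
      by (rule gen_mean_value[OF assms(2)]) (use U_uniform_bound that in simp)
    also have "\<dots> \<le> 1 * (M * exp \<omega> * norm y)"
      using that M_ge_1 by (intro mult_right_mono) auto
    finally show ?thesis by simp
  qed
  have "norm (U 1 x - x - 1 *\<^sub>R a) \<le> \<bar>1\<bar> * (M * exp \<omega> * norm y)"
    by (rule gen_mean_value[OF assms(1)]) (use near in simp)
  moreover have "norm a \<le> norm (U 1 x) + norm x + norm (U 1 x - x - a)"
    by norm
  ultimately show ?thesis using U_uniform_bound[of 1 x] by (simp add: algebra_simps)
qed

text \<open>
  The square of the generator is closed: by the interpolation inequality the middle terms of a
  convergent sequence form a Cauchy sequence.
\<close>

lemma gen2_closed:
  assumes "\<And>n. gen (x n) (a n)" "\<And>n. gen (a n) (y n)" "x \<longlonglongrightarrow> x0" "y \<longlonglongrightarrow> y0"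
  shows "\<exists>b. gen x0 b \<and> gen b y0"
proof -
  have "Cauchy a"
  proof (rule CauchyI)
    fix e :: real assume e: "e > 0"
    define C where "C = M * exp \<omega> + 1"
    have C: "C > 0" using M_ge_1 by (simp add: C_def add_pos_pos)
    have "Cauchy x" "Cauchy y" by (rule assms(3,4)[THEN LIMSEQ_imp_Cauchy])+
    moreover have "e / (2 * C) > 0" using e C by simp
    ultimately obtain N1 N2 where N:
      "\<And>m n. m \<ge> N1 \<Longrightarrow> n \<ge> N1 \<Longrightarrow> norm (x m - x n) < e / (2 * C)"
      "\<And>m n. m \<ge> N2 \<Longrightarrow> n \<ge> N2 \<Longrightarrow> norm (y m - y n) < e / (2 * C)"
      by (meson CauchyD)
    show "\<exists>N. \<forall>m\<ge>N. \<forall>n\<ge>N. norm (a m - a n) < e"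
    proof (intro exI[of _ "max N1 N2"] allI impI)
      fix m n assume mn: "m \<ge> max N1 N2" "n \<ge> max N1 N2"
      have "norm (a m - a n) \<le> C * norm (x m - x n) + M * exp \<omega> * norm (y m - y n)"
        unfolding C_def by (intro gen_interpolation gen_diff assms)
      also have "\<dots> \<le> C * norm (x m - x n) + C * norm (y m - y n)"
        by (intro add_mono mult_right_mono) (auto simp: C_def)
      also have "\<dots> < C * (e / (2 * C)) + C * (e / (2 * C))"
        using N(1)[of m n] N(2)[of m n] mn C by (intro add_strict_mono mult_strict_left_mono) auto
      also have "\<dots> = e" using C by (simp add: field_simps)
      finally show "norm (a m - a n) < e" .
    qed
  qed
  then obtain b where "a \<longlonglongrightarrow> b" using Cauchy_convergent_iff convergent_def by blast
  then show ?thesis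
    using gen_closed[OF assms(1,3)] gen_closed[OF assms(2) _ assms(4)] by blast
qed

section \<open>Weighted averages of a group\<close>

text \<open>
  The weights decay strictly faster than the group can grow, so that all averages converge.
\<close>

definition admissible :: "(real \<Rightarrow> complex) \<Rightarrow> real \<Rightarrow> bool" where
  "admissible f c \<longleftrightarrow> continuous_on UNIV f \<and> (\<forall>s. cmod (f s) \<le> c * exp (- ((\<omega> + 1) * \<bar>s\<bar>)))"

definition Phi :: "(real \<Rightarrow> complex) \<Rightarrow> 'a \<Rightarrow> 'a" where
  "Phi f x = integral UNIV (\<lambda>s. f s *\<^sub>C U s x)"

lemma admissible_nonneg:
  assumes "admissible f c"
  shows "c \<ge> 0"
proof -
  have "cmod (f 0) \<le> c * exp (- ((\<omega> + 1) * \<bar>0\<bar>))" using assms unfolding admissible_def by blast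
  then have "cmod (f 0) \<le> c" by simp
  then show ?thesis by (rule order_trans[OF norm_ge_zero])
qed

lemma integrand_bound:
  assumes "admissible f c"
  shows "norm (f s *\<^sub>C U s x) \<le> (c * M * norm x) * exp (- (1 * \<bar>s\<bar>))"
proof -
  have "norm (f s *\<^sub>C U s x) \<le> (c * exp (- ((\<omega> + 1) * \<bar>s\<bar>))) * (M * exp (\<omega> * \<bar>s\<bar>) * norm x)"
    unfolding norm_scaleC using assms admissible_nonneg[OF assms]
    by (intro mult_mono bound) (auto simp: admissible_def)
  also have "\<dots> = (c * M * norm x) * exp (- ((\<omega> + 1) * \<bar>s\<bar>) + \<omega> * \<bar>s\<bar>)"
    by (simp only: exp_add) (simp add: mult_ac)
  finally show ?thesis by (simp add: algebra_simps)
qed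

lemma integrand_cont: "continuous_on UNIV f \<Longrightarrow> continuous_on UNIV (\<lambda>s. f s *\<^sub>C U s x)"
  by (intro continuous_intros cont)

lemma Phi_integrable:
  assumes "admissible f c"
  shows "(\<lambda>s. f s *\<^sub>C U s x) integrable_on UNIV"
  using assms
  by (intro exp_decay_integrable[OF _ _ integrand_bound] integrand_cont) (auto simp: admissible_def)

lemma Phi_has_integral:
  "admissible f c \<Longrightarrow> ((\<lambda>s. f s *\<^sub>C U s x) has_integral Phi f x) UNIV"
  unfolding Phi_def using Phi_integrable by (rule integrable_integral)

lemma Phi_bound:
  assumes "admissible f c"
  shows "norm (Phi f x) \<le> 2 * c * M * norm x"
  using exp_decay_integral_bound[OF _ _ integrand_bound[OF assms], of x] assms
  unfolding Phi_def by (auto simp: admissible_def integrand_cont mult_ac)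

lemma Phi_diff:
  "admissible f c \<Longrightarrow> admissible g d \<Longrightarrow> Phi (\<lambda>s. f s - g s) x = Phi f x - Phi g x"
  unfolding Phi_def
  by (simp add: complex_vector.scale_left_diff_distrib integral_diff Phi_integrable)

lemma Phi_clinear:
  assumes "admissible f c"
  shows "bounded_clinear (Phi f)"
proof -
  have lin: "Phi f (x + y) = Phi f x + Phi f y" for x y
    unfolding Phi_def
    by (simp add: U_plus scaleC_add_right integral_add[OF Phi_integrable[OF assms] Phi_integrable[OF assms]])
  have scal: "Phi f (b *\<^sub>C x) = b *\<^sub>C Phi f x" for b x
  proof -
    have "(\<lambda>s. f s *\<^sub>C U s (b *\<^sub>C x)) = (*\<^sub>C) b \<circ> (\<lambda>s. f s *\<^sub>C U s x)"
      by (simp add: fun_eq_iff bounded_clinear_scaleC[OF clinear] scaleC_scaleC mult.commute)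
    then show ?thesis
      unfolding Phi_def
      by (simp add: integral_linear[OF Phi_integrable[OF assms]
            bounded_clinear_linear[OF bounded_clinear_scaleC_right]])
  qed
  have "bounded_linear (Phi f)"
  proof (rule bounded_linear_intro)
    show "Phi f (r *\<^sub>R x) = r *\<^sub>R Phi f x" for r x
      using scal[of "of_real r"] by (simp add: scaleC_of_real)
    show "norm (Phi f x) \<le> norm x * (2 * c * M)" for x
      using Phi_bound[OF assms, of x] by (simp add: mult_ac)
  qed (rule lin)
  then show ?thesis by (simp add: bounded_clinear_def scal)
qed

lemma Phi_scale:
  assumes "admissible f c"
  shows "Phi (\<lambda>s. b * f s) x = b *\<^sub>C Phi f x"
proof -
  have "(\<lambda>s. (b * f s) *\<^sub>C U s x) = (*\<^sub>C) b \<circ> (\<lambda>s. f s *\<^sub>C U s x)"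
    by (simp add: fun_eq_iff scaleC_scaleC)
  then show ?thesis
    unfolding Phi_def
    by (simp add: integral_linear[OF Phi_integrable[OF assms]
          bounded_clinear_linear[OF bounded_clinear_scaleC_right]])
qed

lemma Phi_commuting:
  assumes "admissible f c" "bounded_clinear L" "\<And>t x. L (U t x) = U t (L x)"
  shows "L (Phi f x) = Phi f (L x)"
proof -
  have "L (Phi f x) = integral UNIV (L \<circ> (\<lambda>s. f s *\<^sub>C U s x))"
    unfolding Phi_def
    by (rule integral_linear[OF Phi_integrable[OF assms(1)] bounded_clinear_linear[OF assms(2)], symmetric])
  also have "L \<circ> (\<lambda>s. f s *\<^sub>C U s x) = (\<lambda>s. f s *\<^sub>C U s (L x))"
    by (simp add: fun_eq_iff bounded_clinear_scaleC[OF assms(2)] assms(3))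
  finally show ?thesis by (simp add: Phi_def)
qed

text \<open>Reflecting the integration variable undoes the time reversal caused by \<open>J\<close>,
  and an even weight does not notice the reflection.\<close>

lemma Phi_even:
  assumes "admissible f c" "\<And>s. f (- s) = f s" "bounded_clinear J" "\<And>t x. J (U t x) = U (- t) (J x)"
  shows "J (Phi f x) = Phi f (J x)"
proof -
  have "((J \<circ> (\<lambda>s. f s *\<^sub>C U s x)) has_integral J (Phi f x)) UNIV"
    by (rule has_integral_linear[OF Phi_has_integral[OF assms(1)] bounded_clinear_linear[OF assms(3)]])
  from has_integral_UNIV_reflect[OF this]
  have "((\<lambda>s. f s *\<^sub>C U s (J x)) has_integral J (Phi f x)) UNIV"
    by (simp add: bounded_clinear_scaleC[OF assms(3)] assms(2,4))
  then show ?thesis by (simp add: Phi_def integral_unique)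
qed

text \<open>Translation of the integration variable moves the group from the vector to the weight.
  Averages thus become differentiable along the group for arbitrary \<open>x\<close>, as soon as the
  weight is smooth.\<close>

lemma U_Phi:
  assumes "admissible f c"
  shows "U h (Phi f x) = Phi (\<lambda>s. f (s - h)) x"
proof -
  have "((U h \<circ> (\<lambda>s. f s *\<^sub>C U s x)) has_integral U h (Phi f x)) UNIV"
    by (rule has_integral_linear[OF Phi_has_integral[OF assms] linear_U])
  from has_integral_UNIV_translate[OF this, of "-h"]
  have "((\<lambda>s. f (s - h) *\<^sub>C U s x) has_integral U h (Phi f x)) UNIV"
    by (simp add: bounded_clinear_scaleC[OF clinear] flip: add)
  then show ?thesis by (simp add: Phi_def integral_unique)
qed

lemma admissible_shift:
  assumes "admissible f c"
  shows "admissible (\<lambda>s. f (s - h)) (c * exp ((\<omega> + 1) * \<bar>h\<bar>))"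
  unfolding admissible_def
proof (intro conjI allI)
  show "continuous_on UNIV (\<lambda>s. f (s - h))"
  proof (rule continuous_on_compose2[of UNIV f])
    show "continuous_on UNIV f" using assms by (simp add: admissible_def)
  qed (auto intro!: continuous_intros)
  fix s
  have "cmod (f (s - h)) \<le> c * exp (- ((\<omega> + 1) * \<bar>s - h\<bar>))"
    using assms by (simp add: admissible_def)
  also have "\<dots> \<le> c * exp ((\<omega> + 1) * \<bar>h\<bar> + - ((\<omega> + 1) * \<bar>s\<bar>))"
  proof -
    have "(\<omega> + 1) * (\<bar>s\<bar> - \<bar>h\<bar>) \<le> (\<omega> + 1) * \<bar>s - h\<bar>"
      using omega_nonneg by (intro mult_left_mono) auto
    then show ?thesis using admissible_nonneg[OF assms] by (intro mult_left_mono) (auto simp: algebra_simps)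
  qed
  finally show "cmod (f (s - h)) \<le> c * exp ((\<omega> + 1) * \<bar>h\<bar>) * exp (- ((\<omega> + 1) * \<bar>s\<bar>))"
    by (simp only: exp_add mult.assoc)
qed

text \<open>Integration by parts without integrating: \<open>U h\<close> turns the weight into
  \<open>f (s - h)\<close>, whence the minus sign, and a quadratic remainder with admissible decay
  leaves an error of order \<open>h\<close> in the difference quotient.\<close>

lemma Phi_gen:
  assumes f: "admissible f c" and f': "admissible f' c'"
    and diff: "\<And>h s. \<bar>h\<bar> < 1 \<Longrightarrow> cmod (f (s + h) - f s - h * f' s) \<le> K * h\<^sup>2 * exp (- ((\<omega> + 1) * \<bar>s\<bar>))"
  shows "gen (Phi f x) (- Phi f' x)"
  unfolding gen_def
proof (rule LIM_I)
  fix e :: real assume e: "e > 0"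
  have est: "norm ((1 / h) *\<^sub>R (U h (Phi f x) - Phi f x) - - Phi f' x) \<le> \<bar>h\<bar> * (2 * K * M * norm x)"
    if h: "h \<noteq> 0" "\<bar>h\<bar> < 1" for h
  proof -
    have adm: "admissible (\<lambda>s. f (s - h) - f s - of_real (- h) * f' s) (K * h\<^sup>2)"
      unfolding admissible_def
      using diff[of "-h"] h f f' admissible_shift[OF f, of h]
      by (auto simp: admissible_def intro!: continuous_intros)
    have adm1: "admissible (\<lambda>s. f (s - h) - f s) (c * exp ((\<omega> + 1) * \<bar>h\<bar>) + c)" 
      "admissible (\<lambda>s. of_real (- h) * f' s) (\<bar>h\<bar> * c')"
      using f f' admissible_shift[OF f, of h]
      by (auto simp: admissible_def norm_mult distrib_right mult.assoc intro!: continuous_intros mult_left_mono order_trans[OF norm_triangle_ineq4] add_mono)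
    have "U h (Phi f x) - Phi f x + h *\<^sub>R Phi f' x = Phi (\<lambda>s. f (s - h) - f s - of_real (- h) * f' s) x"
      unfolding U_Phi[OF f] Phi_diff[OF adm1] Phi_diff[OF admissible_shift[OF f] f] Phi_scale[OF f']
        scaleC_of_real by simp
    then have "norm (U h (Phi f x) - Phi f x + h *\<^sub>R Phi f' x) \<le> 2 * (K * h\<^sup>2) * M * norm x"
      using Phi_bound[OF adm] by simp
    moreover have "(1 / h) *\<^sub>R (U h (Phi f x) - Phi f x) - - Phi f' x
        = (1 / h) *\<^sub>R (U h (Phi f x) - Phi f x + h *\<^sub>R Phi f' x)"
      using h by (simp add: scaleR_add_right)
    ultimately have "norm ((1 / h) *\<^sub>R (U h (Phi f x) - Phi f x) - - Phi f' x)
        \<le> (2 * (K * h\<^sup>2) * M * norm x) / \<bar>h\<bar>"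
      by (simp add: divide_right_mono)
    also have "\<dots> = \<bar>h\<bar> * (2 * K * M * norm x)"
      using h by (simp add: field_simps power2_eq_square)
    finally show ?thesis .
  qed
  define C where "C = 2 * K * M * norm x"
  \<comment> \<open>\<open>K\<close> carries no sign, so \<open>\<bar>C\<bar> + 1\<close> serves as
    a positive bound.\<close>
  define d where "d = min 1 (e / (\<bar>C\<bar> + 1))"
  show "\<exists>s>0. \<forall>h. h \<noteq> 0 \<and> norm (h - 0) < s \<longrightarrow>
      norm ((1 / h) *\<^sub>R (U h (Phi f x) - Phi f x) - - Phi f' x) < e"
  proof (intro exI[of _ d] conjI allI impI)
    show "d > 0" using e by (simp add: d_def add_nonneg_pos)
    fix h :: real assume h: "h \<noteq> 0 \<and> norm (h - 0) < d"
    have "norm ((1 / h) *\<^sub>R (U h (Phi f x) - Phi f x) - - Phi f' x) \<le> \<bar>h\<bar> * C"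
      using est[of h] h by (simp add: d_def C_def)
    also have "\<dots> \<le> \<bar>h\<bar> * (\<bar>C\<bar> + 1)" by (intro mult_left_mono) auto
    also have "\<dots> < e / (\<bar>C\<bar> + 1) * (\<bar>C\<bar> + 1)" using h by (intro mult_strict_right_mono) (auto simp: d_def)
    also have "\<dots> = e" by simp
    finally show "norm ((1 / h) *\<^sub>R (U h (Phi f x) - Phi f x) - - Phi f' x) < e" .
  qed
qed

end

section \<open>The complex heat kernel\<close>

text \<open>Discs of radius \<open>r / 2\<close> around points of the inner ball stay in the outer
  one. Cauchy's inequality there bounds the second derivative by
  \<open>2 * K / (r / 2)\<^sup>2\<close>, the constant of the claim, and Taylor's formula does the
  rest.\<close>

lemma holomorphic_linearization:
  assumes "f holomorphic_on ball z (2 * r)" "\<And>u. u \<in> ball z (2 * r) \<Longrightarrow> norm (f u) \<le> K"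
    and "w \<in> ball z r"
  shows "norm (f w - f z - (w - z) * deriv f z) \<le> 8 * K / r\<^sup>2 * (norm (w - z))\<^sup>2"
proof -
  have r: "r > 0" using assms(3) by (metis ball_eq_empty emptyE not_le)
  have op: "open (ball z (2*r))" "ball z r \<subseteq> ball z (2*r)" using r by auto
  have bd: "norm ((deriv ^^ 2) f u) \<le> 8 * K / r\<^sup>2" if u: "u \<in> ball z r" for u
  proof -
    have sub: "cball u (r/2) \<subseteq> ball z (2*r)"
    proof
      fix v assume "v \<in> cball u (r/2)"
      then show "v \<in> ball z (2*r)" using u dist_triangle[of z v u] r by auto
    qed
    have "norm ((deriv ^^ 2) f u) \<le> fact 2 * K / (r/2)^2"
    proof (rule Cauchy_inequality)
      show "f holomorphic_on ball u (r/2)"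
        by (rule holomorphic_on_subset[OF assms(1)]) (use sub ball_subset_cball in blast)
      show "continuous_on (cball u (r/2)) f"
        by (intro holomorphic_on_imp_continuous_on holomorphic_on_subset[OF assms(1)] sub)
      show "norm (f x) \<le> K" if "norm (u - x) = r/2" for x
        by (rule assms(2)) (use that sub in \<open>auto simp: dist_norm\<close>)
    qed (use r in auto)
    also have "\<dots> = 8 * K / r\<^sup>2" by (simp add: fact_2 power_divide)
    finally show ?thesis .
  qed
  have der: "((deriv ^^ i) f has_field_derivative (deriv ^^ (Suc i)) f u) (at u within ball z r)"
    if "u \<in> ball z r" for i u
  proof -
    have "(deriv ^^ i) f holomorphic_on ball z (2*r)"
      by (intro holomorphic_higher_deriv assms op)
    from holomorphic_derivI[OF this op(1), of u] that op show ?thesis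
      by (auto intro: has_field_derivative_at_within)
  qed
  have "norm ((deriv ^^ 0) f w - (\<Sum>i\<le>1. (deriv ^^ i) f z * (w - z) ^ i / fact i))
      \<le> (8 * K / r\<^sup>2) * norm (w - z) ^ Suc 1 / fact 1"
    by (rule field_Taylor[of "ball z r"]) (use assms r bd der in \<open>auto simp: numeral_2_eq_2\<close>)
  then show ?thesis by (simp add: power2_eq_square mult.commute diff_diff_eq)
qed

text \<open>The Gaussian kernel with \<open>sqrt (4 pi z)\<close> written as
  \<open>2 sqrt (pi z)\<close>; the principal root is holomorphic on the right half-plane. The space
  variable is complex too, so that Cauchy estimates apply in it.\<close>

definition heat :: "complex \<Rightarrow> complex \<Rightarrow> complex" where
  "heat z s = exp (- (s\<^sup>2 / (4 * z))) / (2 * csqrt (of_real pi * z))"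

definition heat_s :: "complex \<Rightarrow> complex \<Rightarrow> complex" where
  "heat_s z s = - (s / (2 * z)) * heat z s"

definition heat_ss :: "complex \<Rightarrow> complex \<Rightarrow> complex" where
  "heat_ss z s = (s\<^sup>2 / (4 * z\<^sup>2) - 1 / (2 * z)) * heat z s"

lemma heat_even: "heat z (- s) = heat z s"
  by (simp add: heat_def)

lemma DERIV_heat: "Re z > 0 \<Longrightarrow> (heat z has_field_derivative heat_s z s) (at s)"
  unfolding heat_def[abs_def] heat_s_def
  by (rule DERIV_cong[OF DERIV_cdivide]) (auto intro!: derivative_eq_intros simp: field_simps)

lemma DERIV_heat_s:
  assumes "Re z > 0"
  shows "(heat_s z has_field_derivative heat_ss z s) (at s)"
proof -
  have "z \<noteq> 0" using assms by auto
  have "((\<lambda>s. - (s / (2 * z))) has_field_derivative - (1 / (2 * z))) (at s)"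
    using \<open>z \<noteq> 0\<close> by (auto intro!: derivative_eq_intros)
  from DERIV_mult[OF this DERIV_heat[OF assms]] show ?thesis
    unfolding heat_s_def[abs_def]
    by (rule DERIV_cong) (use \<open>z \<noteq> 0\<close> in \<open>simp add: heat_ss_def field_simps power2_eq_square\<close>)
qed

text \<open>The heat equation. Through it, time derivatives of averages become second space
  derivatives of the weight, that is, the square of the generator.\<close>

lemma DERIV_heat_time:
  assumes "Re z > 0"
  shows "((\<lambda>z. heat z s) has_field_derivative heat_ss z s) (at z)"
proof -
  have z: "z \<noteq> 0" "of_real pi * z \<notin> \<real>\<^sub>\<le>\<^sub>0" "csqrt (of_real pi * z) \<noteq> 0"
    using assms pi_gt_zero by (auto simp: complex_nonpos_Reals_iff mult_le_0_iff simp del: pi_gt_zero)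
  define c where "c = csqrt (of_real pi * z)"
  have c: "c * c = of_real pi * z" "c \<noteq> 0"
    using z power2_csqrt[of "of_real pi * z"] by (simp_all add: c_def power2_eq_square)
  have "((\<lambda>z. heat z s) has_field_derivative
     (exp (- (s\<^sup>2 / (4 * z))) * (s\<^sup>2 / (4 * z\<^sup>2)) * (2 * c) - exp (- (s\<^sup>2 / (4 * z))) * (of_real pi / c))
       / (2 * c * (2 * c))) (at z)"
    unfolding heat_def c_def using z
    by (auto intro!: derivative_eq_intros simp: power2_eq_square field_simps)
  then show ?thesis
  proof (rule DERIV_cong)
    have pi: "of_real pi / c = c / z" using c z by (simp add: field_simps)
    show "(exp (- (s\<^sup>2 / (4 * z))) * (s\<^sup>2 / (4 * z\<^sup>2)) * (2 * c) - exp (- (s\<^sup>2 / (4 * z))) * (of_real pi / c))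
       / (2 * c * (2 * c)) = heat_ss z s"
      unfolding heat_ss_def heat_def c_def[symmetric] pi using c(2) z(1)
      by (simp add: field_simps)
  qed
qed

lemma Re_of_real_mult: "Re (of_real r * w) = r * Re w"
  by simp

lemma cmod_csqrt_pi: "cmod (csqrt (of_real pi * z)) = sqrt (pi * cmod z)"
proof -
  have "(cmod (csqrt (of_real pi * z)))\<^sup>2 = pi * cmod z"
    by (simp add: norm_mult flip: norm_power)
  then show ?thesis by (metis norm_ge_zero real_sqrt_unique)
qed

text \<open>Completing the square. It trades Gaussian decay for exponential decay of any prescribed
  rate \<open>B\<close>, at the price of a constant.\<close>

lemma quadratic_le: "c > 0 \<Longrightarrow> B * t - c * t\<^sup>2 / 4 \<le> B\<^sup>2 / c" for B t c :: real
  using zero_le_power2[of "c * t / 2 - B"] by (simp add: field_simps power2_eq_square)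

text \<open>
  Bounds that are uniform in a complex neighbourhood of the time and of the space variable, so that
  Cauchy's inequalities control the second order Taylor remainders in both variables.
\<close>

lemma heat_bounds:
  assumes z0: "Re z0 > 0" and a: "a \<ge> 0"
  obtains r K where "r > 0"
    "\<And>z. z \<in> ball z0 (2 * r) \<Longrightarrow> Re z > 0"
    "\<And>z \<sigma> s. z \<in> ball z0 (2 * r) \<Longrightarrow> cmod \<sigma> < 2 \<Longrightarrow> cmod (heat z (of_real s + \<sigma>)) \<le> K * exp (- (a * \<bar>s\<bar>))"
    "\<And>z \<sigma> s. z \<in> ball z0 (2 * r) \<Longrightarrow> cmod \<sigma> < 2 \<Longrightarrow> cmod (heat_s z (of_real s + \<sigma>)) \<le> K * exp (- (a * \<bar>s\<bar>))"
    "\<And>z \<sigma> s. z \<in> ball z0 (2 * r) \<Longrightarrow> cmod \<sigma> < 2 \<Longrightarrow> cmod (heat_ss z (of_real s + \<sigma>)) \<le> K * exp (- (a * \<bar>s\<bar>))"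
proof -
  \<comment> \<open>On the disc of radius \<open>p\<close> around \<open>z0\<close>,
    \<open>Re z\<close> is at least \<open>p\<close> and \<open>cmod z\<close> at most
    \<open>R\<close>; hence \<open>c\<close> bounds
    \<open>Re (1 / z) = Re z / (cmod z)\<^sup>2\<close> from below and \<open>m\<close> bounds
    \<open>cmod (1 / z)\<close> from above. In \<open>B\<close>, the term \<open>m\<close> absorbs
    the cross term produced by the complex shift, \<open>a\<close> is the required rate, and 2 is a
    reserve for the polynomial factors of the derivatives.\<close>
  define p where "p = Re z0 / 2"
  define R where "R = cmod z0 + p"
  define c where "c = p / R\<^sup>2"
  define m where "m = 1 / p"
  define B where "B = m + a + 2"
  define K0 where "K0 = exp (m + B\<^sup>2 / c) / (2 * sqrt (pi * p))"
  define K where "K = K0 * (1 + m + m\<^sup>2)"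
  have p: "p > 0" using z0 by (simp add: p_def)
  have R: "R > 0" using p by (simp add: R_def add_nonneg_pos)
  have c: "c > 0" using p R by (simp add: c_def)
  have m: "m > 0" using p by (simp add: m_def)
  have K0: "K0 > 0" using p by (simp add: K0_def)
  have zbd: "p \<le> Re z" "cmod z \<le> R" "p \<le> cmod z" "c \<le> Re (1 / z)" "cmod (1 / z) \<le> m"
    if "z \<in> ball z0 (2 * (p / 2))" for z
  proof -
    have d: "cmod (z0 - z) < p" using that by (simp add: dist_norm)
    then have "Re z0 - Re z < p" using complex_Re_le_cmod[of "z0 - z"] by simp
    then show p1: "p \<le> Re z" by (simp add: p_def)
    show p2: "cmod z \<le> R" using d norm_triangle_sub[of z z0] by (simp add: R_def norm_minus_commute)
    show p3: "p \<le> cmod z" using p1 complex_Re_le_cmod[of z] by linarith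
    have "c \<le> Re z / (cmod z)\<^sup>2"
      unfolding c_def using p p1 p2 p3 by (intro frac_le power_mono) auto
    then show "c \<le> Re (1 / z)" by (simp add: Re_divide cmod_power2)
    show "cmod (1 / z) \<le> m" using p p3 by (simp add: m_def norm_divide frac_le)
  qed
  \<comment> \<open>The kernel itself decays at rate \<open>a + 2\<close>. Its space derivatives
    carry factors of degree at most two in \<open>s\<close>, and each degree costs one
    \<open>exp \<bar>s\<bar>\<close>.\<close>
  have h0: "cmod (heat z (of_real s + \<sigma>)) \<le> K0 * exp (- ((a + 2) * \<bar>s\<bar>))"
    if z: "z \<in> ball z0 (2 * (p / 2))" and \<sigma>: "cmod \<sigma> < 2" for z \<sigma> and s :: real
  proof -
    have eq: "(of_real s + \<sigma>)\<^sup>2 / (4 * z) = of_real (s\<^sup>2 / 4) * (1 / z) + (2 * of_real s * \<sigma> + \<sigma>\<^sup>2) / 4 * (1 / z)"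
    proof -
      have "(of_real s + \<sigma>)\<^sup>2 / (4 * z) = ((of_real s + \<sigma>)\<^sup>2 / 4) * (1 / z)" by simp
      also have "(of_real s + \<sigma>)\<^sup>2 / 4 = of_real (s\<^sup>2 / 4) + (2 * of_real s * \<sigma> + \<sigma>\<^sup>2) / 4"
        by (simp add: power2_sum add_divide_distrib)
      finally show ?thesis by (simp only: distrib_right)
    qed
    have "cmod ((2 * of_real s * \<sigma> + \<sigma>\<^sup>2) / 4 * (1 / z)) \<le> (\<bar>s\<bar> + 1) * m"
      unfolding norm_mult[of _ "1 / z"]
    proof (intro mult_mono zbd(5)[OF z])
      have "cmod (2 * of_real s * \<sigma> + \<sigma>\<^sup>2) \<le> 2 * \<bar>s\<bar> * cmod \<sigma> + (cmod \<sigma>)\<^sup>2"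
        by (rule order_trans[OF norm_triangle_ineq]) (simp add: norm_mult norm_power)
      also have "\<dots> \<le> 2 * \<bar>s\<bar> * 2 + 2\<^sup>2" using \<sigma> by (intro add_mono mult_left_mono power_mono) auto
      finally show "cmod ((2 * of_real s * \<sigma> + \<sigma>\<^sup>2) / 4) \<le> \<bar>s\<bar> + 1" by (simp add: norm_divide)
    qed auto
    then have "Re ((2 * of_real s * \<sigma> + \<sigma>\<^sup>2) / 4 * (1 / z)) \<ge> - ((\<bar>s\<bar> + 1) * m)"
      using abs_Re_le_cmod[of "(2 * of_real s * \<sigma> + \<sigma>\<^sup>2) / 4 * (1 / z)"] by linarith
    moreover have "Re (of_real (s\<^sup>2 / 4) * (1 / z)) \<ge> s\<^sup>2 / 4 * c"
      using zbd(4)[OF z] by (simp only: Re_of_real_mult) (intro mult_left_mono, auto)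
    moreover have "B * \<bar>s\<bar> - c * \<bar>s\<bar>\<^sup>2 / 4 \<le> B\<^sup>2 / c" by (rule quadratic_le[OF c])
    ultimately have "- Re ((of_real s + \<sigma>)\<^sup>2 / (4 * z)) \<le> m + B\<^sup>2 / c - (a + 2) * \<bar>s\<bar>"
      unfolding eq plus_complex.sel
    proof -
      have "B * \<bar>s\<bar> = m * \<bar>s\<bar> + (a + 2) * \<bar>s\<bar>" "(\<bar>s\<bar> + 1) * m = m * \<bar>s\<bar> + m"
        "c * \<bar>s\<bar>\<^sup>2 / 4 = s\<^sup>2 / 4 * c"
        by (simp_all add: B_def algebra_simps)
      moreover assume "- ((\<bar>s\<bar> + 1) * m) \<le> Re ((2 * of_real s * \<sigma> + \<sigma>\<^sup>2) / 4 * (1 / z))"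
        "s\<^sup>2 / 4 * c \<le> Re (of_real (s\<^sup>2 / 4) * (1 / z))" "B * \<bar>s\<bar> - c * \<bar>s\<bar>\<^sup>2 / 4 \<le> B\<^sup>2 / c"
      ultimately show "- (Re (of_real (s\<^sup>2 / 4) * (1 / z)) + Re ((2 * of_real s * \<sigma> + \<sigma>\<^sup>2) / 4 * (1 / z)))
          \<le> m + B\<^sup>2 / c - (a + 2) * \<bar>s\<bar>" by linarith
    qed
    then have "exp (- Re ((of_real s + \<sigma>)\<^sup>2 / (4 * z))) \<le> exp (m + B\<^sup>2 / c) * exp (- ((a + 2) * \<bar>s\<bar>))"
      by (simp flip: exp_add)
    moreover have "2 * sqrt (pi * p) \<le> 2 * sqrt (pi * cmod z)"
      using zbd(3)[OF z] by simp
    ultimately have "exp (- Re ((of_real s + \<sigma>)\<^sup>2 / (4 * z))) / (2 * sqrt (pi * cmod z))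
        \<le> (exp (m + B\<^sup>2 / c) * exp (- ((a + 2) * \<bar>s\<bar>))) / (2 * sqrt (pi * p))"
      using p by (intro frac_le) auto
    then show ?thesis
      by (simp add: heat_def norm_divide norm_mult cmod_csqrt_pi K0_def norm_exp_eq_Re)
  qed
  have lin: "cmod (of_real s + \<sigma>) \<le> 2 * exp \<bar>s\<bar>" if "cmod \<sigma> < 2" for s :: real and \<sigma>
  proof -
    have "cmod (of_real s + \<sigma>) \<le> \<bar>s\<bar> + 2"
      using that norm_triangle_ineq[of "of_real s" \<sigma>] by simp
    also have "\<dots> \<le> 2 * exp \<bar>s\<bar>" using exp_ge_add_one_self[of "\<bar>s\<bar>"] by linarith
    finally show ?thesis .
  qed
  have e2: "exp (- ((a + 2) * \<bar>s\<bar>)) = exp (- (a * \<bar>s\<bar>)) * (exp (- \<bar>s\<bar>) * exp (- \<bar>s\<bar>))" for s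
    by (simp add: algebra_simps flip: exp_add)
  have le1: "exp (- \<bar>s\<bar>) \<le> 1" for s :: real by simp
  show thesis
  proof (rule that[of "p / 2" K])
    show "p / 2 > 0" using p by simp
    fix z assume z: "z \<in> ball z0 (2 * (p / 2))"
    then show "Re z > 0" using zbd(1)[OF z] p by simp
    fix \<sigma> and s :: real assume \<sigma>: "cmod \<sigma> < 2"
    \<comment> \<open>Spends the reserve: a factor growing like the square of
      \<open>exp \<bar>s\<bar>\<close> lowers the rate from \<open>a + 2\<close> to
      \<open>a\<close>.\<close>
    have fin: "x \<le> K * exp (- (a * \<bar>s\<bar>))"
      if "x \<le> q * (K0 * exp (- ((a + 2) * \<bar>s\<bar>)))" "q \<le> (1 + m + m\<^sup>2) * (exp \<bar>s\<bar> * exp \<bar>s\<bar>)" for x q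
    proof -
      have "x \<le> q * (K0 * exp (- ((a + 2) * \<bar>s\<bar>)))" by fact
      also have "\<dots> \<le> ((1 + m + m\<^sup>2) * (exp \<bar>s\<bar> * exp \<bar>s\<bar>)) * (K0 * exp (- ((a + 2) * \<bar>s\<bar>)))"
        using K0 by (intro mult_right_mono that) auto
      also have "\<dots> = K * exp (- (a * \<bar>s\<bar>))"
        unfolding e2 K_def by (simp add: exp_minus field_simps)
      finally show ?thesis .
    qed
    have ge1: "1 \<le> exp \<bar>s\<bar>" by simp
    then have ge2: "exp \<bar>s\<bar> \<le> exp \<bar>s\<bar> * exp \<bar>s\<bar>" "1 \<le> exp \<bar>s\<bar> * exp \<bar>s\<bar>" by simp_all (smt (verit) ge1 mult_le_cancel_left1)
    show "cmod (heat z (of_real s + \<sigma>)) \<le> K * exp (- (a * \<bar>s\<bar>))"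
    proof (rule fin[of _ 1])
      have "1 * 1 \<le> (1 + m + m\<^sup>2) * (exp \<bar>s\<bar> * exp \<bar>s\<bar>)"
        using m ge2 by (intro mult_mono) auto
      then show "1 \<le> (1 + m + m\<^sup>2) * (exp \<bar>s\<bar> * exp \<bar>s\<bar>)" by simp
    qed (use h0[OF z \<sigma>] in simp)
    have q1: "cmod ((of_real s + \<sigma>) / (2 * z)) \<le> m * exp \<bar>s\<bar>"
    proof -
      have "cmod ((of_real s + \<sigma>) / (2 * z)) = cmod (1 / z) * (cmod (of_real s + \<sigma>) / 2)"
        by (simp add: norm_divide norm_mult)
      also have "\<dots> \<le> m * exp \<bar>s\<bar>"
        using lin[OF \<sigma>, of s] m by (intro mult_mono zbd(5)[OF z]) auto
      finally show ?thesis .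
    qed
    show "cmod (heat_s z (of_real s + \<sigma>)) \<le> K * exp (- (a * \<bar>s\<bar>))"
    proof (rule fin)
      show "cmod (heat_s z (of_real s + \<sigma>)) \<le> (m * exp \<bar>s\<bar>) * (K0 * exp (- ((a + 2) * \<bar>s\<bar>)))"
        unfolding heat_s_def norm_mult norm_minus_cancel
        using m by (intro mult_mono q1 h0 z \<sigma>) auto
      show "m * exp \<bar>s\<bar> \<le> (1 + m + m\<^sup>2) * (exp \<bar>s\<bar> * exp \<bar>s\<bar>)"
        using m ge2 by (intro mult_mono) auto
    qed
    show "cmod (heat_ss z (of_real s + \<sigma>)) \<le> K * exp (- (a * \<bar>s\<bar>))"
    proof (rule fin)
      have "cmod ((of_real s + \<sigma>)\<^sup>2 / (4 * z\<^sup>2) - 1 / (2 * z)) \<le> (m * exp \<bar>s\<bar>)\<^sup>2 + m"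
      proof (rule order_trans[OF norm_triangle_ineq4] add_mono)+
        have "cmod ((of_real s + \<sigma>)\<^sup>2 / (4 * z\<^sup>2)) = (cmod ((of_real s + \<sigma>) / (2 * z)))\<^sup>2"
          by (simp add: norm_divide norm_power norm_mult power_divide power_mult_distrib)
        also have "\<dots> \<le> (m * exp \<bar>s\<bar>)\<^sup>2" by (intro power_mono q1) auto
        finally show "cmod ((of_real s + \<sigma>)\<^sup>2 / (4 * z\<^sup>2)) \<le> (m * exp \<bar>s\<bar>)\<^sup>2" .
        show "cmod (1 / (2 * z)) \<le> m" using zbd(5)[OF z] m by (simp add: norm_divide norm_mult)
      qed
      then show "cmod (heat_ss z (of_real s + \<sigma>)) \<le> ((m * exp \<bar>s\<bar>)\<^sup>2 + m) * (K0 * exp (- ((a + 2) * \<bar>s\<bar>)))"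
        unfolding heat_ss_def norm_mult
        using m by (intro mult_mono h0 z \<sigma>) auto
      have "(m * exp \<bar>s\<bar>)\<^sup>2 + m * 1 \<le> m\<^sup>2 * (exp \<bar>s\<bar> * exp \<bar>s\<bar>) + m * (exp \<bar>s\<bar> * exp \<bar>s\<bar>)"
        using m ge2 by (intro add_mono mult_left_mono) (auto simp: power_mult_distrib power2_eq_square)
      also have "\<dots> \<le> (1 + m + m\<^sup>2) * (exp \<bar>s\<bar> * exp \<bar>s\<bar>)" by (simp add: algebra_simps)
      finally show "(m * exp \<bar>s\<bar>)\<^sup>2 + m \<le> (1 + m + m\<^sup>2) * (exp \<bar>s\<bar> * exp \<bar>s\<bar>)" by simp
    qed
  qed
qed

text \<open>The linearization estimate with radius one in the shift variable explains the bounds for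
  \<open>cmod \<sigma> < 2\<close>. They are uniform in \<open>\<sigma>\<close>, so the remainder
  inherits the decay in \<open>s\<close>.\<close>

lemma heat_shift_linearization:
  assumes "Re z > 0" "a \<ge> 0"
  obtains K where
    "\<And>h s. \<bar>h\<bar> < 1 \<Longrightarrow> cmod (heat z (of_real (s + h)) - heat z (of_real s) - of_real h * heat_s z (of_real s))
        \<le> K * h\<^sup>2 * exp (- (a * \<bar>s\<bar>))"
    "\<And>h s. \<bar>h\<bar> < 1 \<Longrightarrow> cmod (heat_s z (of_real (s + h)) - heat_s z (of_real s) - of_real h * heat_ss z (of_real s))
        \<le> K * h\<^sup>2 * exp (- (a * \<bar>s\<bar>))"
proof -
  obtain r K where r: "(r::real) > 0" and
    bd: "\<And>\<sigma> s. cmod \<sigma> < 2 \<Longrightarrow> cmod (heat z (of_real s + \<sigma>)) \<le> K * exp (- (a * \<bar>s\<bar>))"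
    "\<And>\<sigma> s. cmod \<sigma> < 2 \<Longrightarrow> cmod (heat_s z (of_real s + \<sigma>)) \<le> K * exp (- (a * \<bar>s\<bar>))"
  proof (rule heat_bounds[OF assms])
    fix r K
    assume "0 < r"
      "\<And>w \<sigma> s. w \<in> ball z (2 * r) \<Longrightarrow> cmod \<sigma> < 2 \<Longrightarrow> cmod (heat w (of_real s + \<sigma>)) \<le> K * exp (- (a * \<bar>s\<bar>))"
      "\<And>w \<sigma> s. w \<in> ball z (2 * r) \<Longrightarrow> cmod \<sigma> < 2 \<Longrightarrow> cmod (heat_s w (of_real s + \<sigma>)) \<le> K * exp (- (a * \<bar>s\<bar>))"
    then show thesis using that[of r K] by simp
  qed
  have gen: "cmod (f (of_real (s + h)) - f (of_real s) - of_real h * f' (of_real s)) \<le> 8 * K * h\<^sup>2 * exp (- (a * \<bar>s\<bar>))"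
    if der: "\<And>s. (f has_field_derivative f' s) (at s)"
      and f: "\<And>\<sigma> s. cmod \<sigma> < 2 \<Longrightarrow> cmod (f (of_real s + \<sigma>)) \<le> K * exp (- (a * \<bar>s\<bar>))"
      and h: "\<bar>h\<bar> < 1" for f f' and h s :: real
  proof -
    have der': "((\<lambda>\<sigma>. f (of_real s + \<sigma>)) has_field_derivative f' (of_real s + \<sigma>)) (at \<sigma>)" for \<sigma>
      using DERIV_chain2[OF der DERIV_add[OF DERIV_const DERIV_ident], of "of_real s" \<sigma>] by simp
    have "cmod (f (of_real s + of_real h) - f (of_real s + 0) - (of_real h - 0) * deriv (\<lambda>\<sigma>. f (of_real s + \<sigma>)) 0)
        \<le> 8 * (K * exp (- (a * \<bar>s\<bar>))) / 1\<^sup>2 * (cmod (of_real h - 0))\<^sup>2"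
    proof (rule holomorphic_linearization)
      show "(\<lambda>\<sigma>. f (of_real s + \<sigma>)) holomorphic_on ball 0 (2 * 1)"
        by (rule holomorphic_onI)
          (use has_field_derivative_at_within[OF der'] in \<open>unfold field_differentiable_def, blast\<close>)
    qed (use f h in auto)
    then show ?thesis by (simp add: DERIV_imp_deriv[OF der'] mult_ac)
  qed
  show thesis
    by (rule that[of "8 * K"]; rule gen)
      (use DERIV_heat[OF assms(1)] DERIV_heat_s[OF assms(1)] bd in auto)
qed

text \<open>The same Cauchy argument in the time variable; by the heat equation the linear term
  involves \<open>heat_ss\<close>.\<close>

lemma heat_time_linearization:
  assumes "Re z > 0" "a \<ge> 0"
  obtains r K where "r > 0" "\<And>w. w \<in> ball z r \<Longrightarrow> Re w > 0"
    "\<And>w s. w \<in> ball z r \<Longrightarrow> cmod (heat w (of_real s) - heat z (of_real s) - (w - z) * heat_ss z (of_real s))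
        \<le> K * (cmod (w - z))\<^sup>2 * exp (- (a * \<bar>s\<bar>))"
proof -
  obtain r K where r: "r > 0" and pos: "\<And>w. w \<in> ball z (2 * r) \<Longrightarrow> Re w > 0"
    and bd: "\<And>w \<sigma> s. w \<in> ball z (2 * r) \<Longrightarrow> cmod \<sigma> < 2 \<Longrightarrow> cmod (heat w (of_real s + \<sigma>)) \<le> K * exp (- (a * \<bar>s\<bar>))"
    by (rule heat_bounds[OF assms]) blast
  show thesis
  proof (rule that[OF r, of "8 * K / r\<^sup>2"])
    fix w assume w: "w \<in> ball z r"
    then show "Re w > 0" using r by (intro pos) auto
    fix s :: real
    have "cmod (heat w (of_real s) - heat z (of_real s) - (w - z) * deriv (\<lambda>z. heat z (of_real s)) z)
        \<le> 8 * (K * exp (- (a * \<bar>s\<bar>))) / r\<^sup>2 * (cmod (w - z))\<^sup>2"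
    proof (rule holomorphic_linearization[OF _ _ w])
      show "(\<lambda>z. heat z (of_real s)) holomorphic_on ball z (2 * r)"
        by (rule holomorphic_onI)
          (use has_field_derivative_at_within[OF DERIV_heat_time[OF pos]] in
            \<open>unfold field_differentiable_def, blast\<close>)
    qed (use bd[of _ 0 s] in auto)
    then show "cmod (heat w (of_real s) - heat z (of_real s) - (w - z) * heat_ss z (of_real s))
        \<le> 8 * K / r\<^sup>2 * (cmod (w - z))\<^sup>2 * exp (- (a * \<bar>s\<bar>))"
      by (simp add: DERIV_imp_deriv[OF DERIV_heat_time[OF assms(1)]] mult_ac)
  qed
qed

lemma sector_half_plane: "sector (pi / 2) = {z. Re z > 0}"
  using Arg_Re_pos by (auto simp: sector_def simp del: divide_less_eq_numeral1 less_divide_eq_numeral1)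

text \<open>In a proper subsector \<open>Re (1 / z)\<close> is at least
  \<open>cos \<delta> / cmod z\<close>, so the exponent is quadratic in
  \<open>\<bar>s\<bar> / sqrt (cmod z)\<close>. Completing the square in this scaled variable gives
  a constant independent of \<open>z\<close>; for positive \<open>B\<close> the bound has an
  integral independent of \<open>z\<close> as well.\<close>

lemma heat_sector_bound:
  assumes "0 < \<delta>" "\<delta> < pi / 2"
  obtains K where
    "\<And>z s. z \<in> sector \<delta> \<Longrightarrow> cmod (heat z (of_real s)) \<le> K / sqrt (cmod z) * exp (- (B / sqrt (cmod z) * \<bar>s\<bar>))"
proof
  fix z and s :: real assume z: "z \<in> sector \<delta>"
  define c where "c = cos \<delta>"
  define \<rho> where "\<rho> = cmod z"
  have c: "c > 0" using assms by (simp add: c_def cos_gt_zero)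
  have \<rho>: "\<rho> > 0" "z \<noteq> 0" using z by (auto simp: sector_def \<rho>_def)
  have "c \<le> cos (Arg z)"
    using z assms cos_monotone_0_pi_le[of "\<bar>Arg z\<bar>" \<delta>] by (auto simp: sector_def c_def)
  then have Re: "c / \<rho> \<le> Re (1 / z)"
  proof -
    assume "c \<le> cos (Arg z)"
    then have "c * cmod z \<le> Re z" using \<rho> by (simp add: cos_Arg \<rho>_def field_simps)
    then have "(c * cmod z) / (cmod z)\<^sup>2 \<le> Re z / (cmod z)\<^sup>2" by (rule divide_right_mono) simp
    moreover have "(c * cmod z) / (cmod z)\<^sup>2 = c / \<rho>" using \<rho> by (simp add: \<rho>_def power2_eq_square)
    ultimately show ?thesis by (simp add: Re_divide cmod_power2)
  qed
  have "Re ((of_real s)\<^sup>2 / (4 * z)) = s\<^sup>2 / 4 * Re (1 / z)"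
  proof -
    have "(of_real s)\<^sup>2 / (4 * z) = of_real (s\<^sup>2 / 4) * (1 / z)" by simp
    then show ?thesis by (simp only: Re_of_real_mult)
  qed
  moreover have "s\<^sup>2 / 4 * Re (1 / z) \<ge> s\<^sup>2 / 4 * (c / \<rho>)" by (intro mult_left_mono Re) auto
  moreover have "B * (\<bar>s\<bar> / sqrt \<rho>) - c * (\<bar>s\<bar> / sqrt \<rho>)\<^sup>2 / 4 \<le> B\<^sup>2 / c" by (rule quadratic_le[OF c])
  ultimately have "- Re ((of_real s)\<^sup>2 / (4 * z)) \<le> B\<^sup>2 / c + - (B / sqrt \<rho> * \<bar>s\<bar>)"
  proof -
    have "c * (\<bar>s\<bar> / sqrt \<rho>)\<^sup>2 / 4 = s\<^sup>2 / 4 * (c / \<rho>)" "B * (\<bar>s\<bar> / sqrt \<rho>) = B / sqrt \<rho> * \<bar>s\<bar>"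
      using \<rho> by (simp_all add: power_divide mult_ac)
    moreover assume "Re ((of_real s)\<^sup>2 / (4 * z)) = s\<^sup>2 / 4 * Re (1 / z)"
      "s\<^sup>2 / 4 * (c / \<rho>) \<le> s\<^sup>2 / 4 * Re (1 / z)"
      "B * (\<bar>s\<bar> / sqrt \<rho>) - c * (\<bar>s\<bar> / sqrt \<rho>)\<^sup>2 / 4 \<le> B\<^sup>2 / c"
    ultimately show ?thesis by linarith
  qed
  then have "exp (- Re ((of_real s)\<^sup>2 / (4 * z))) \<le> exp (B\<^sup>2 / c) * exp (- (B / sqrt \<rho> * \<bar>s\<bar>))"
    by (simp flip: exp_add)
  then have "exp (- Re ((of_real s)\<^sup>2 / (4 * z))) / (2 * sqrt (pi * \<rho>))
      \<le> (exp (B\<^sup>2 / c) * exp (- (B / sqrt \<rho> * \<bar>s\<bar>))) / (2 * sqrt (pi * \<rho>))"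
    using \<rho> by (intro divide_right_mono) auto
  then show "cmod (heat z (of_real s)) \<le> (exp (B\<^sup>2 / cos \<delta>) / (2 * sqrt pi)) / sqrt (cmod z) * exp (- (B / sqrt (cmod z) * \<bar>s\<bar>))"
    by (simp add: heat_def norm_divide norm_mult cmod_csqrt_pi norm_exp_eq_Re real_sqrt_mult flip: c_def \<rho>_def)
qed

text \<open>At time one the kernel is the normal density of variance 2.\<close>

lemma heat_1_normalised:
  "((\<lambda>s. exp (- (s\<^sup>2 / 4)) / (2 * sqrt pi)) has_integral 1) UNIV"
proof -
  have "(normal_density 0 (sqrt 2) has_integral 1) UNIV"
    using has_integral_integral_lborel[OF integrable_normal_density[of "sqrt 2" 0]]
    by simp
  moreover have "normal_density 0 (sqrt 2) = (\<lambda>s. exp (- (s\<^sup>2 / 4)) / (2 * sqrt pi))"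
    by (simp add: normal_density_def fun_eq_iff real_sqrt_mult)
  ultimately show ?thesis by simp
qed

lemma heat_1: "heat 1 (of_real s) = of_real (exp (- (s\<^sup>2 / 4)) / (2 * sqrt pi))"
  by (simp add: heat_def exp_of_real[symmetric])

lemma continuous_on_of_real_DERIV:
  assumes "\<And>s. (f has_field_derivative f' s) (at s)"
  shows "continuous_on UNIV (\<lambda>s::real. f (of_real s :: complex) :: complex)"
  by (rule continuous_on_compose2[of UNIV f])
    (auto intro!: continuous_at_imp_continuous_on DERIV_isCont[OF assms] continuous_intros)

lemma continuous_on_heat:
  assumes "Re z > 0"
  shows "continuous_on UNIV (\<lambda>s. heat z (of_real s))"
    "continuous_on UNIV (\<lambda>s. heat_s z (of_real s))"
    "continuous_on UNIV (\<lambda>s. heat_ss z (of_real s))"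
proof -
  show c: "continuous_on UNIV (\<lambda>s. heat z (of_real s))"
    by (rule continuous_on_of_real_DERIV[OF DERIV_heat[OF assms]])
  show "continuous_on UNIV (\<lambda>s. heat_s z (of_real s))"
    by (rule continuous_on_of_real_DERIV[OF DERIV_heat_s[OF assms]])
  show "continuous_on UNIV (\<lambda>s. heat_ss z (of_real s))"
    unfolding heat_ss_def by (intro continuous_intros c) (use assms in auto)
qed

section \<open>The Gaussian average of a group\<close>

context C0_group_bounded
begin

definition heat_op :: "complex \<Rightarrow> 'a \<Rightarrow> 'a" where
  "heat_op z = Phi (\<lambda>s. heat z (of_real s))"

text \<open>Plays two roles: it is the time derivative of \<open>heat_op z\<close> and also the
  squared generator applied after \<open>heat_op z\<close>.\<close>

definition heat_op' :: "complex \<Rightarrow> 'a \<Rightarrow> 'a" where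
  "heat_op' z = Phi (\<lambda>s. heat_ss z (of_real s))"

lemma heat_admissible:
  assumes "Re z > 0"
  obtains c where "admissible (\<lambda>s. heat z (of_real s)) c"
    "admissible (\<lambda>s. heat_s z (of_real s)) c" "admissible (\<lambda>s. heat_ss z (of_real s)) c"
proof (rule heat_bounds[OF assms, of "\<omega> + 1"])
  show "0 \<le> \<omega> + 1" using omega_nonneg by simp
  fix r c
  assume "0 < r"
    "\<And>w \<sigma> s. w \<in> ball z (2 * r) \<Longrightarrow> cmod \<sigma> < 2 \<Longrightarrow> cmod (heat w (of_real s + \<sigma>)) \<le> c * exp (- ((\<omega> + 1) * \<bar>s\<bar>))"
    "\<And>w \<sigma> s. w \<in> ball z (2 * r) \<Longrightarrow> cmod \<sigma> < 2 \<Longrightarrow> cmod (heat_s w (of_real s + \<sigma>)) \<le> c * exp (- ((\<omega> + 1) * \<bar>s\<bar>))"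
    "\<And>w \<sigma> s. w \<in> ball z (2 * r) \<Longrightarrow> cmod \<sigma> < 2 \<Longrightarrow> cmod (heat_ss w (of_real s + \<sigma>)) \<le> c * exp (- ((\<omega> + 1) * \<bar>s\<bar>))"
  from this(1) this(2-4)[of z 0] show thesis
    by (intro that[of c]) (simp_all add: admissible_def continuous_on_heat assms)
qed

lemma heat_op_clinear: "Re z > 0 \<Longrightarrow> bounded_clinear (heat_op z)"
  unfolding heat_op_def by (metis heat_admissible Phi_clinear)

lemma heat_op'_clinear: "Re z > 0 \<Longrightarrow> bounded_clinear (heat_op' z)"
  unfolding heat_op'_def by (metis heat_admissible Phi_clinear)

lemma heat_op_commute_U: "Re z > 0 \<Longrightarrow> U t (heat_op z x) = heat_op z (U t x)"
  unfolding heat_op_def by (metis heat_admissible Phi_commuting clinear U_commute)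

lemma gen_uminus: "gen x y \<Longrightarrow> gen (- x) (- y)"
  by (rule gen_commuting[OF bounded_linear_minus[OF bounded_linear_ident]]) (simp_all add: U_uminus)

text \<open>Each application of the generator differentiates the weight and changes the sign; the
  two signs cancel.\<close>

lemma gen_heat_op:
  assumes z: "Re z > 0"
  obtains a where "gen (heat_op z x) a" "gen a (heat_op' z x)"
proof -
  have om: "\<omega> + 1 \<ge> 0" using omega_nonneg by simp
  obtain c where c: "admissible (\<lambda>s. heat z (of_real s)) c"
    "admissible (\<lambda>s. heat_s z (of_real s)) c" "admissible (\<lambda>s. heat_ss z (of_real s)) c"
    by (rule heat_admissible[OF z])
  obtain K where K:
    "\<And>h s. \<bar>h\<bar> < 1 \<Longrightarrow> cmod (heat z (of_real (s + h)) - heat z (of_real s) - of_real h * heat_s z (of_real s))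
        \<le> K * h\<^sup>2 * exp (- ((\<omega> + 1) * \<bar>s\<bar>))"
    "\<And>h s. \<bar>h\<bar> < 1 \<Longrightarrow> cmod (heat_s z (of_real (s + h)) - heat_s z (of_real s) - of_real h * heat_ss z (of_real s))
        \<le> K * h\<^sup>2 * exp (- ((\<omega> + 1) * \<bar>s\<bar>))"
    by (rule heat_shift_linearization[OF z om]) blast
  show thesis
  proof (rule that)
    show "gen (heat_op z x) (- Phi (\<lambda>s. heat_s z (of_real s)) x)"
      unfolding heat_op_def by (rule Phi_gen[OF c(1,2) K(1)])
    show "gen (- Phi (\<lambda>s. heat_s z (of_real s)) x) (heat_op' z x)"
      using gen_uminus[OF Phi_gen[OF c(2,3) K(2)], of x] by (simp add: heat_op'_def)
  qed
qed

text \<open>\<open>heat_op z\<close> commutes with the group and hence with its generator, so both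
  sides are the squared generator applied to \<open>heat_op z x\<close>.\<close>

lemma gen2_imp_heat_op':
  assumes z: "Re z > 0" and x: "gen x a" "gen a y"
  shows "heat_op' z x = heat_op z y"
proof -
  have com: "gen u v \<Longrightarrow> gen (heat_op z u) (heat_op z v)" for u v
    by (rule gen_commuting[OF bounded_clinear_linear[OF heat_op_clinear[OF z]]])
      (simp add: heat_op_commute_U[OF z])
  obtain b where b: "gen (heat_op z x) b" "gen b (heat_op' z x)" by (rule gen_heat_op[OF z])
  have "b = heat_op z a" by (rule gen_unique[OF b(1) com[OF x(1)]])
  then show ?thesis using gen_unique[OF _ com[OF x(2)]] b(2) by blast
qed

text \<open>Smoothing puts \<open>heat_op w x\<close> into the domain of the squared generator, so
  commutation applies to every \<open>x\<close>. This is the cancellation behind the semigroup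
  law.\<close>

lemma heat_op_heat_op':
  assumes "Re z > 0" "Re w > 0"
  shows "heat_op z (heat_op' w x) = heat_op' z (heat_op w x)"
  by (metis gen_heat_op[OF assms(2)] gen2_imp_heat_op'[OF assms(1)])

text \<open>The Taylor remainder of the kernel in time, averaged over the group. Its bound is linear
  in \<open>norm x\<close>, which yields differentiability in operator norm and not only
  pointwise.\<close>

lemma heat_op_linearization:
  assumes z: "Re z > 0"
  obtains r C where "r > 0" "C \<ge> 0" "\<And>w. w \<in> ball z r \<Longrightarrow> Re w > 0"
    "\<And>w x. w \<in> ball z r \<Longrightarrow> norm (heat_op w x - heat_op z x - (w - z) *\<^sub>C heat_op' z x) \<le> C * (cmod (w - z))\<^sup>2 * norm x"
proof -
  have om: "\<omega> + 1 \<ge> 0" using omega_nonneg by simp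
  obtain r K where r: "r > 0" and pos: "\<And>w. w \<in> ball z r \<Longrightarrow> Re w > 0"
    and K: "\<And>w s. w \<in> ball z r \<Longrightarrow> cmod (heat w (of_real s) - heat z (of_real s) - (w - z) * heat_ss z (of_real s))
        \<le> K * (cmod (w - z))\<^sup>2 * exp (- ((\<omega> + 1) * \<bar>s\<bar>))"
    by (rule heat_time_linearization[OF z om]) blast
  obtain c where c: "admissible (\<lambda>s. heat z (of_real s)) c" "admissible (\<lambda>s. heat_ss z (of_real s)) c"
    by (rule heat_admissible[OF z])
  show thesis
  proof (rule that[OF r _ pos, of "\<bar>2 * K * M\<bar>"])
    fix w x assume w: "w \<in> ball z r"
    obtain d where d: "admissible (\<lambda>s. heat w (of_real s)) d"
      by (rule heat_admissible[OF pos[OF w]])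
    have adm: "admissible (\<lambda>s. heat w (of_real s) - heat z (of_real s)) (d + c)"
      "admissible (\<lambda>s. (w - z) * heat_ss z (of_real s)) (cmod (w - z) * c)"
      using c d
      by (auto simp: admissible_def norm_mult distrib_right mult.assoc intro!: continuous_intros
          mult_left_mono order_trans[OF norm_triangle_ineq4] add_mono)
    have "admissible (\<lambda>s. heat w (of_real s) - heat z (of_real s) - (w - z) * heat_ss z (of_real s)) (K * (cmod (w - z))\<^sup>2)"
      using K[OF w] adm by (auto simp: admissible_def intro!: continuous_intros)
    from Phi_bound[OF this, of x]
    have "norm (heat_op w x - heat_op z x - (w - z) *\<^sub>C heat_op' z x) \<le> (2 * K * M) * (cmod (w - z))\<^sup>2 * norm x"
      unfolding Phi_diff[OF adm] Phi_diff[OF d c(1)] Phi_scale[OF c(2)] heat_op_def heat_op'_def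
      by (simp add: mult_ac)
    also have "\<dots> \<le> \<bar>2 * K * M\<bar> * (cmod (w - z))\<^sup>2 * norm x"
      by (intro mult_right_mono) auto
    finally show "norm (heat_op w x - heat_op z x - (w - z) *\<^sub>C heat_op' z x) \<le> \<bar>2 * K * M\<bar> * (cmod (w - z))\<^sup>2 * norm x" .
  qed simp
qed

section \<open>Analyticity in operator norm\<close>

lemma heat_op_operator_analytic: "operator_analytic_on heat_op {z. Re z > 0}"
  unfolding operator_analytic_on_def
proof clarify
  fix z assume z: "Re z > 0"
  obtain r C where C0: "C \<ge> 0" and r: "r > 0" "\<And>w. w \<in> ball z r \<Longrightarrow> Re w > 0"
    and C: "\<And>w x. w \<in> ball z r \<Longrightarrow> norm (heat_op w x - heat_op z x - (w - z) *\<^sub>C heat_op' z x) \<le> C * (cmod (w - z))\<^sup>2 * norm x"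
    by (rule heat_op_linearization[OF z]) blast
  have "((\<lambda>w. onorm (\<lambda>x. (1 / (w - z)) *\<^sub>C (heat_op w x - heat_op z x) - heat_op' z x)) \<longlongrightarrow> 0) (at z)"
  proof (rule Lim_null_comparison)
    have "((\<lambda>w. C * cmod (w - z)) \<longlongrightarrow> C * cmod (z - z)) (at z)"
      by (intro tendsto_intros)
    then show "((\<lambda>w. C * cmod (w - z)) \<longlongrightarrow> 0) (at z)" by simp
    show "\<forall>\<^sub>F w in at z. norm (onorm (\<lambda>x. (1 / (w - z)) *\<^sub>C (heat_op w x - heat_op z x) - heat_op' z x)) \<le> C * cmod (w - z)"
      unfolding eventually_at
    proof (intro exI[of _ r] conjI ballI impI)
      fix w assume w: "w \<noteq> z \<and> dist w z < r"
      then have wb: "w \<in> ball z r" by (simp add: dist_commute)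
      have "bounded_linear (\<lambda>x. (1 / (w - z)) *\<^sub>C (heat_op w x - heat_op z x) - heat_op' z x)"
        by (intro bounded_linear_sub bounded_linear_compose[OF bounded_clinear_linear[OF bounded_clinear_scaleC_right]]
            bounded_clinear_linear heat_op_clinear heat_op'_clinear z r(2) wb)
      then have "0 \<le> onorm (\<lambda>x. (1 / (w - z)) *\<^sub>C (heat_op w x - heat_op z x) - heat_op' z x)" by (rule onorm_pos_le)
      moreover have "onorm (\<lambda>x. (1 / (w - z)) *\<^sub>C (heat_op w x - heat_op z x) - heat_op' z x) \<le> C * cmod (w - z)"
      proof (rule onorm_bound)
        show "0 \<le> C * cmod (w - z)" using C0 by simp
        fix x
        have "(1 / (w - z)) *\<^sub>C (heat_op w x - heat_op z x) - heat_op' z x = (1 / (w - z)) *\<^sub>C (heat_op w x - heat_op z x - (w - z) *\<^sub>C heat_op' z x)"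
          using w by (simp add: complex_vector.scale_right_diff_distrib scaleC_scaleC scaleC_one)
        then have "norm ((1 / (w - z)) *\<^sub>C (heat_op w x - heat_op z x) - heat_op' z x)
            = norm (heat_op w x - heat_op z x - (w - z) *\<^sub>C heat_op' z x) / cmod (w - z)"
          by (simp add: norm_scaleC norm_divide)
        also have "\<dots> \<le> C * (cmod (w - z))\<^sup>2 * norm x / cmod (w - z)"
          by (intro divide_right_mono C wb) auto
        also have "\<dots> = C * cmod (w - z) * norm x" using w by (simp add: power2_eq_square)
        finally show "norm ((1 / (w - z)) *\<^sub>C (heat_op w x - heat_op z x) - heat_op' z x) \<le> C * cmod (w - z) * norm x" .
      qed
      ultimately show "norm (onorm (\<lambda>x. (1 / (w - z)) *\<^sub>C (heat_op w x - heat_op z x) - heat_op' z x)) \<le> C * cmod (w - z)"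
        by simp
    qed (rule r)
  qed
  then show "\<exists>L. bounded_clinear L \<and>
      ((\<lambda>w. onorm (\<lambda>x. (1 / (w - z)) *\<^sub>C (heat_op w x - heat_op z x) - L x)) \<longlongrightarrow> 0) (at z)"
    using heat_op'_clinear[OF z] by blast
qed

text \<open>The same derivative inside the Banach space of bounded operators, where the chain rule,
  the product rule and the constancy theorems of calculus apply.\<close>

lemma heat_op_blinfun_has_derivative:
  assumes z: "Re z > 0"
  shows "((\<lambda>z. Blinfun (heat_op z)) has_derivative (\<lambda>h. Blinfun (\<lambda>x. h *\<^sub>C heat_op' z x))) (at z)"
proof -
  obtain r C where C0: "C \<ge> 0" and r: "r > 0" "\<And>w. w \<in> ball z r \<Longrightarrow> Re w > 0"
    and C: "\<And>w x. w \<in> ball z r \<Longrightarrow> norm (heat_op w x - heat_op z x - (w - z) *\<^sub>C heat_op' z x) \<le> C * (cmod (w - z))\<^sup>2 * norm x"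
    by (rule heat_op_linearization[OF z]) blast
  have lin: "bounded_linear (\<lambda>x. h *\<^sub>C heat_op' z x)" for h
    by (intro bounded_linear_compose[OF bounded_clinear_linear[OF bounded_clinear_scaleC_right]]
        bounded_clinear_linear heat_op'_clinear z)
  note ap = bounded_linear_Blinfun_apply
  show ?thesis
    unfolding has_derivative_at
  proof
    show "bounded_linear (\<lambda>h. Blinfun (\<lambda>x. h *\<^sub>C heat_op' z x))"
    proof (rule bounded_linear_intro)
      show "Blinfun (\<lambda>x. (g + h) *\<^sub>C heat_op' z x) = Blinfun (\<lambda>x. g *\<^sub>C heat_op' z x) + Blinfun (\<lambda>x. h *\<^sub>C heat_op' z x)" for g h
        by (rule blinfun_eqI) (simp only: ap[OF lin] blinfun.add_left, simp only: scaleC_add_left)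
      show "Blinfun (\<lambda>x. (q *\<^sub>R h) *\<^sub>C heat_op' z x) = q *\<^sub>R Blinfun (\<lambda>x. h *\<^sub>C heat_op' z x)" for q h
        by (rule blinfun_eqI)
          (simp only: ap[OF lin] blinfun.scaleR_left, simp only: bounded_bilinear.scaleR_left[OF bounded_bilinear_scaleC])
      show "norm (Blinfun (\<lambda>x. h *\<^sub>C heat_op' z x)) \<le> norm h * onorm (heat_op' z)" for h
        by (rule norm_blinfun_bound)
          (auto simp: ap[OF lin] norm_scaleC mult.assoc
            intro!: mult_nonneg_nonneg mult_left_mono onorm[OF bounded_clinear_linear[OF heat_op'_clinear[OF z]]]
            onorm_pos_le[OF bounded_clinear_linear[OF heat_op'_clinear[OF z]]])
    qed
    show "(\<lambda>h. norm (Blinfun (heat_op (z + h)) - Blinfun (heat_op z) - Blinfun (\<lambda>x. h *\<^sub>C heat_op' z x)) / norm h) \<midarrow>0\<rightarrow> 0"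
    proof (rule Lim_null_comparison)
      have "((\<lambda>h::complex. C * cmod h) \<longlongrightarrow> C * cmod 0) (at 0)"
        by (intro tendsto_intros)
      then show "((\<lambda>h::complex. C * cmod h) \<longlongrightarrow> 0) (at 0)" by simp
      show "\<forall>\<^sub>F h in at 0. norm (norm (Blinfun (heat_op (z + h)) - Blinfun (heat_op z) - Blinfun (\<lambda>x. h *\<^sub>C heat_op' z x)) / norm h) \<le> C * cmod h"
        unfolding eventually_at
      proof (intro exI[of _ r] conjI ballI impI)
        fix h :: complex assume h: "h \<noteq> 0 \<and> dist h 0 < r"
        then have wb: "z + h \<in> ball z r" by (simp add: dist_norm)
        have "norm (Blinfun (heat_op (z + h)) - Blinfun (heat_op z) - Blinfun (\<lambda>x. h *\<^sub>C heat_op' z x)) \<le> C * (cmod h)\<^sup>2"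
        proof (rule norm_blinfun_bound)
          fix x
          have "norm (heat_op (z + h) x - heat_op z x - h *\<^sub>C heat_op' z x) \<le> C * (cmod h)\<^sup>2 * norm x"
            using C[OF wb, of x] by simp
          then show "norm (blinfun_apply (Blinfun (heat_op (z + h)) - Blinfun (heat_op z) - Blinfun (\<lambda>x. h *\<^sub>C heat_op' z x)) x) \<le> C * (cmod h)\<^sup>2 * norm x"
            by (simp add: blinfun.diff_left ap[OF lin] ap[OF bounded_clinear_linear[OF heat_op_clinear[OF z]]]
                ap[OF bounded_clinear_linear[OF heat_op_clinear[OF r(2)[OF wb]]]])
        qed (simp add: C0)
        then show "norm (norm (Blinfun (heat_op (z + h)) - Blinfun (heat_op z) - Blinfun (\<lambda>x. h *\<^sub>C heat_op' z x)) / norm h) \<le> C * cmod h"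
          using h by (simp add: field_simps power2_eq_square)
      qed (rule r)
    qed
  qed
qed

end

text \<open>
  For the trivial group the generator is zero, hence the Gaussian average does not depend on the
  time and can be evaluated at time one.
\<close>

lemma heat_normalised:
  fixes x :: "'a::complex_banach"
  assumes "Re z > 0"
  shows "((\<lambda>s. heat z (of_real s) *\<^sub>C x) has_integral x) UNIV"
proof -
  interpret triv: C0_group_bounded "\<lambda>t (x::'a). x" 1 0
    by unfold_locales (auto simp: bounded_clinear_def bounded_linear_ident)
  have "triv.heat_op' w y = 0" if "Re w > 0" for w y
  proof -
    note w = that
    obtain a where "triv.gen a (triv.heat_op' w y)" by (rule triv.gen_heat_op[OF w])
    moreover have "triv.gen a 0" by (simp add: triv.gen_def)
    ultimately show ?thesis by (rule triv.gen_unique)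
  qed
  then have "((\<lambda>z. Blinfun (triv.heat_op z)) has_derivative (\<lambda>h. 0)) (at w within {z. Re z > 0})"
    if "w \<in> {z. Re z > 0}" for w
    using triv.heat_op_blinfun_has_derivative[of w] that
    by (auto intro: has_derivative_at_withinI simp: zero_blinfun_def)
  \<comment> \<open>Constancy needs a convex domain: the right half-plane contains the segment from
    \<open>z\<close> to 1.\<close>
  then have "Blinfun (triv.heat_op z) = Blinfun (triv.heat_op 1)"
    by (rule has_derivative_zero_unique[OF convex_halfspace_Re_gt]) (use assms in auto)
  then have "triv.heat_op z x = triv.heat_op 1 x"
    using assms bounded_linear_Blinfun_apply[OF bounded_clinear_linear[OF triv.heat_op_clinear]]
    by (metis one_complex.sel(1) zero_less_one)
  also have "triv.heat_op 1 x = x"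
    unfolding triv.heat_op_def triv.Phi_def heat_1 scaleC_of_real
    by (rule integral_unique) (use has_integral_scaleR_left[OF heat_1_normalised, of x] in simp)
  finally show ?thesis
    using triv.heat_admissible[OF assms] triv.Phi_has_integral[of _ _ x]
    unfolding triv.heat_op_def by metis
qed

section \<open>Strong continuity at zero\<close>

context C0_group_bounded
begin

text \<open>An approximate identity argument: as the kernel has mass one, the difference
  \<open>heat_op z x - x\<close> averages \<open>U s x - x\<close>. Instead of splitting the
  integral into small and large \<open>s\<close>, one exponential bound at the scale
  \<open>sqrt (cmod z)\<close> covers both ranges.\<close>

lemma heat_op_tendsto:
  assumes \<delta>: "0 < \<delta>" "\<delta> < pi / 2"
  shows "((\<lambda>z. heat_op z x) \<longlongrightarrow> x) (at 0 within sector \<delta>)"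
proof (rule tendstoI)
  fix e :: real assume e: "e > 0"
  \<comment> \<open>The rate \<open>\<omega> + 2\<close> exceeds the rate
    \<open>\<omega> + 1\<close> of \<open>near\<close> by one. What remains integrates to
    \<open>2 q\<close>, which cancels the factor \<open>1 / q\<close> of the kernel.\<close>
  obtain K' where K': "\<And>z s. z \<in> sector \<delta> \<Longrightarrow>
      cmod (heat z (of_real s)) \<le> K' / sqrt (cmod z) * exp (- ((\<omega> + 2) / sqrt (cmod z) * \<bar>s\<bar>))"
    by (rule heat_sector_bound[OF \<delta>]) blast
  define K where "K = \<bar>K'\<bar> + 1"
  have Kpos: "K > 0" by (simp add: K_def)
  define \<epsilon> where "\<epsilon> = e / (4 * K)"
  have \<epsilon>: "\<epsilon> > 0" using e Kpos by (simp add: \<epsilon>_def)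
  obtain d where d: "d > 0" "\<And>s. \<bar>s\<bar> < d \<Longrightarrow> norm (U s x - x) < \<epsilon>"
    using U_near[OF \<epsilon>] by blast
  \<comment> \<open>Ensures \<open>q \<le> 1\<close>, so that \<open>\<omega>\<close> may be
    replaced by \<open>\<omega> / q\<close>, and makes \<open>2 * M * norm x\<close> at most
    \<open>\<epsilon> * d / q\<close>. For \<open>\<bar>s\<bar> \<ge> d\<close> the latter is at
    most \<open>\<epsilon> * exp (\<bar>s\<bar> / q)\<close>. The added 1 guards against
    \<open>x = 0\<close>.\<close>
  define \<eta> where "\<eta> = min 1 (\<epsilon> * d / (2 * M * norm x + 1))"
  have Mx: "2 * M * norm x \<ge> 0" using M_ge_1 by simp
  have \<eta>: "\<eta> > 0" using \<epsilon> d Mx by (simp add: \<eta>_def)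
  have est: "norm (heat_op z x - x) \<le> 2 * (K * \<epsilon>)" if z: "z \<in> sector \<delta>" "cmod z < \<eta>\<^sup>2" for z
  proof -
    define q where "q = sqrt (cmod z)"
    have Re: "Re z > 0" using z(1) \<delta> Arg_Re_pos[of z] by (fastforce simp: sector_def)
    then have q: "q > 0" by (auto simp: q_def)
    have "q < \<eta>" using real_sqrt_less_mono[OF z(2)] \<eta> by (simp add: q_def)
    then have q1: "q \<le> 1" "q * (2 * M * norm x + 1) \<le> \<epsilon> * d"
      using Mx by (auto simp: \<eta>_def field_simps)
    have near: "norm (U s x - x) \<le> \<epsilon> * exp ((\<omega> + 1) / q * \<bar>s\<bar>)" for s
    proof (cases "\<bar>s\<bar> < d")
      case True
      have "1 \<le> exp ((\<omega> + 1) / q * \<bar>s\<bar>)" using q omega_nonneg by simp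
      then have "\<epsilon> * 1 \<le> \<epsilon> * exp ((\<omega> + 1) / q * \<bar>s\<bar>)" using \<epsilon> by (intro mult_left_mono) auto
      then show ?thesis using d(2)[OF True] by linarith
    next
      case False
      have "1 * norm x \<le> (M * exp (\<omega> * \<bar>s\<bar>)) * norm x"
      proof (rule mult_right_mono)
        have "1 * 1 \<le> M * exp (\<omega> * \<bar>s\<bar>)" using M_ge_1 omega_nonneg by (intro mult_mono) auto
        then show "1 \<le> M * exp (\<omega> * \<bar>s\<bar>)" by simp
      qed simp
      then have "norm (U s x - x) \<le> exp (\<omega> * \<bar>s\<bar>) * (2 * M * norm x)"
        using bound[of s x] norm_triangle_ineq4[of "U s x" x] by (simp add: algebra_simps)
      also have "\<dots> \<le> exp (\<omega> / q * \<bar>s\<bar>) * (\<epsilon> * exp (\<bar>s\<bar> / q))"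
      proof (rule mult_mono)
        show "exp (\<omega> * \<bar>s\<bar>) \<le> exp (\<omega> / q * \<bar>s\<bar>)"
        proof -
          have "\<omega> \<le> \<omega> / q" using q q1 omega_nonneg by (simp add: le_divide_eq mult_left_le)
          then have "\<omega> * \<bar>s\<bar> \<le> \<omega> / q * \<bar>s\<bar>" by (rule mult_right_mono) simp
          then show ?thesis by simp
        qed
        have "2 * M * norm x \<le> \<epsilon> * (d / q)" using q1(2) q by (simp add: field_simps)
        also have "\<dots> \<le> \<epsilon> * exp (\<bar>s\<bar> / q)"
        proof (rule mult_left_mono)
          show "d / q \<le> exp (\<bar>s\<bar> / q)"
            using False q exp_ge_add_one_self[of "\<bar>s\<bar> / q"] divide_right_mono[of d "\<bar>s\<bar>" q] by linarith
        qed (use \<epsilon> in simp)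
        finally show "2 * M * norm x \<le> \<epsilon> * exp (\<bar>s\<bar> / q)" .
      qed (use Mx in auto)
      also have "\<dots> = \<epsilon> * exp ((\<omega> + 1) / q * \<bar>s\<bar>)"
      proof -
        have "(\<omega> + 1) / q * \<bar>s\<bar> = \<omega> / q * \<bar>s\<bar> + \<bar>s\<bar> / q"
          by (simp add: add_divide_distrib distrib_right)
        then show ?thesis by (simp only: exp_add mult_ac)
      qed
      finally show ?thesis .
    qed
    obtain c where c: "admissible (\<lambda>s. heat z (of_real s)) c" by (rule heat_admissible[OF Re])
    have "((\<lambda>s. heat z (of_real s) *\<^sub>C U s x - heat z (of_real s) *\<^sub>C x) has_integral (heat_op z x - x)) UNIV"
      unfolding heat_op_def by (intro has_integral_diff Phi_has_integral[OF c] heat_normalised[OF Re])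
    then have eq: "heat_op z x - x = integral UNIV (\<lambda>s. heat z (of_real s) *\<^sub>C (U s x - x))"
      by (simp add: complex_vector.scale_right_diff_distrib integral_unique)
    have "norm (integral UNIV (\<lambda>s. heat z (of_real s) *\<^sub>C (U s x - x))) \<le> 2 * (K / q * \<epsilon>) / (1 / q)"
    proof (rule exp_decay_integral_bound)
      show "1 / q > 0" using q by simp
      show "continuous_on UNIV (\<lambda>s. heat z (of_real s) *\<^sub>C (U s x - x))"
        by (intro continuous_intros cont continuous_on_heat Re)
      fix s
      have "cmod (heat z (of_real s)) \<le> K' / q * exp (- ((\<omega> + 2) / q * \<bar>s\<bar>))"
        using K'[OF z(1), of s] by (simp add: q_def)
      also have "\<dots> \<le> K / q * exp (- ((\<omega> + 2) / q * \<bar>s\<bar>))"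
        using q by (intro mult_right_mono divide_right_mono) (auto simp: K_def)
      finally have "norm (heat z (of_real s) *\<^sub>C (U s x - x))
          \<le> (K / q * exp (- ((\<omega> + 2) / q * \<bar>s\<bar>))) * (\<epsilon> * exp ((\<omega> + 1) / q * \<bar>s\<bar>))"
        unfolding norm_scaleC using q Kpos by (intro mult_mono near) auto
      also have "\<dots> = K / q * \<epsilon> * (exp (- ((\<omega> + 2) / q * \<bar>s\<bar>)) * exp ((\<omega> + 1) / q * \<bar>s\<bar>))" by simp
      also have "exp (- ((\<omega> + 2) / q * \<bar>s\<bar>)) * exp ((\<omega> + 1) / q * \<bar>s\<bar>) = exp (- (1 / q * \<bar>s\<bar>))"
      proof -
        have "- ((\<omega> + 2) / q * \<bar>s\<bar>) + (\<omega> + 1) / q * \<bar>s\<bar> = - (1 / q * \<bar>s\<bar>)"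
          using q by (simp add: field_simps)
        then show ?thesis by (simp only: flip: exp_add)
      qed
      finally show "norm (heat z (of_real s) *\<^sub>C (U s x - x)) \<le> K / q * \<epsilon> * exp (- (1 / q * \<bar>s\<bar>))" .
    qed
    then show ?thesis unfolding eq using q by simp
  qed
  have "2 * (K * \<epsilon>) < e" using e Kpos by (simp add: \<epsilon>_def)
  then show "\<forall>\<^sub>F z in at 0 within sector \<delta>. dist (heat_op z x) x < e"
    unfolding eventually_at using est \<eta>
    by (intro exI[of _ "\<eta>\<^sup>2"]) (fastforce simp: dist_norm)
qed

lemma heat_op_tendsto_ray:
  assumes w: "Re w > 0"
  shows "((\<lambda>t. heat_op (of_real t * w) x) \<longlongrightarrow> x) (at_right 0)"
proof -
  have "w \<noteq> 0" using w by auto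
  have "\<bar>Arg w\<bar> < pi / 2" using w Arg_Re_pos[of w] by blast
  then obtain \<delta> where \<delta>: "\<bar>Arg w\<bar> < \<delta>" "\<delta> < pi / 2" using dense by blast
  have "filterlim (\<lambda>t. of_real t * w) (at 0 within sector \<delta>) (at_right 0)"
    unfolding filterlim_at
  proof
    show "\<forall>\<^sub>F t in at_right 0. of_real t * w \<in> sector \<delta> \<and> of_real t * w \<noteq> 0"
      using \<open>w \<noteq> 0\<close> \<delta> by (auto simp: eventually_at_filter sector_def)
    have "((\<lambda>t. of_real t * w) \<longlongrightarrow> of_real 0 * w) (at_right 0)" by (intro tendsto_intros)
    then show "((\<lambda>t. of_real t * w) \<longlongrightarrow> 0) (at_right 0)" by simp
  qed
  moreover have "((\<lambda>z. heat_op z x) \<longlongrightarrow> x) (at 0 within sector \<delta>)"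
    using \<delta> by (intro heat_op_tendsto) auto
  ultimately show ?thesis by (rule filterlim_compose[rotated])
qed

lemma heat_op_tendsto_sequence: "(\<lambda>n. heat_op (of_real (inverse (real (Suc n)))) x) \<longlonglongrightarrow> x"
proof -
  have "filterlim (\<lambda>n. inverse (real (Suc n))) (at_right 0) sequentially"
    unfolding filterlim_at using LIMSEQ_inverse_real_of_nat by auto
  from filterlim_compose[OF heat_op_tendsto_ray[of 1 x] this] show ?thesis by simp
qed

section \<open>The semigroup law\<close>

lemma heat_op_blinfun_apply: "Re z > 0 \<Longrightarrow> blinfun_apply (Blinfun (heat_op z)) = heat_op z"
  by (simp add: bounded_linear_Blinfun_apply bounded_clinear_linear heat_op_clinear)

lemma heat_op_blinfun_has_vector_derivative:
  assumes "Re (z + of_real s * w) > 0"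
  shows "((\<lambda>s. Blinfun (heat_op (z + of_real s * w))) has_vector_derivative Blinfun (\<lambda>x. w *\<^sub>C heat_op' (z + of_real s * w) x)) (at s)"
proof -
  have lin: "bounded_linear (\<lambda>x. h *\<^sub>C heat_op' (z + of_real s * w) x)" for h
    by (intro bounded_linear_compose[OF bounded_clinear_linear[OF bounded_clinear_scaleC_right]]
        bounded_clinear_linear heat_op'_clinear assms)
  have "((\<lambda>s. z + of_real s * w) has_derivative (\<lambda>h. of_real h * w)) (at s)"
    by (auto intro!: derivative_eq_intros)
  from has_derivative_compose[OF this heat_op_blinfun_has_derivative[OF assms]]
  have "((\<lambda>s. Blinfun (heat_op (z + of_real s * w))) has_derivative
      (\<lambda>h. Blinfun (\<lambda>x. (of_real h * w) *\<^sub>C heat_op' (z + of_real s * w) x))) (at s)" .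
  moreover have "Blinfun (\<lambda>x. (of_real h * w) *\<^sub>C heat_op' (z + of_real s * w) x)
      = h *\<^sub>R Blinfun (\<lambda>x. w *\<^sub>C heat_op' (z + of_real s * w) x)" for h
    by (rule blinfun_eqI)
      (simp only: bounded_linear_Blinfun_apply[OF lin] blinfun.scaleR_left,
        simp only: scaleC_scaleC[symmetric] scaleC_of_real)
  ultimately show ?thesis by (simp add: has_vector_derivative_def)
qed

text \<open>
  The function \<open>s \<mapsto> heat_op (z + s w) (heat_op ((1 - s) w) x)\<close> has derivative zero on \<open>[0, 1)\<close>.
\<close>

lemma heat_op_add:
  assumes z: "Re z > 0" and w: "Re w > 0"
  shows "heat_op (z + w) x = heat_op z (heat_op w x)"
proof -
  \<comment> \<open>The second factor is written with direction \<open>- w\<close> so that the same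
    derivative rule serves both factors.\<close>
  define \<psi> where "\<psi> s = blinfun_apply (Blinfun (heat_op (z + of_real s * w))) (blinfun_apply (Blinfun (heat_op (w + of_real s * (- w)))) x)" for s
  have pos: "Re (z + of_real s * w) > 0" "Re (w + of_real s * (- w)) > 0" if "s \<in> {0..<1}" for s
  proof -
    show "Re (z + of_real s * w) > 0" using z w that by (simp add: add_pos_nonneg)
    have "(1 - s) * Re w > 0" using w that by simp
    then show "Re (w + of_real s * (- w)) > 0" by (simp add: algebra_simps)
  qed
  have "(\<psi> has_vector_derivative 0) (at s within {0..<1})" if s: "s \<in> {0..<1}" for s
  proof -
    let ?a = "z + of_real s * w" and ?b = "w + of_real s * (- w)"
    have lin: "bounded_linear (\<lambda>x. h *\<^sub>C heat_op' u x)" if "Re u > 0" for h u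
      by (intro bounded_linear_compose[OF bounded_clinear_linear[OF bounded_clinear_scaleC_right]]
          bounded_clinear_linear heat_op'_clinear that)
    note ap = bounded_linear_Blinfun_apply
    have "((\<lambda>s. blinfun_apply (Blinfun (heat_op (w + of_real s * (- w)))) x) has_vector_derivative
        blinfun_apply (Blinfun (\<lambda>x. (- w) *\<^sub>C heat_op' ?b x)) x) (at s)"
      by (rule bounded_linear.has_vector_derivative[OF blinfun.bounded_linear_left
            heat_op_blinfun_has_vector_derivative[OF pos(2)[OF s]]])
    from bounded_bilinear.has_vector_derivative[OF bounded_bilinear_blinfun_apply
        heat_op_blinfun_has_vector_derivative[OF pos(1)[OF s]] this]
    have "(\<psi> has_vector_derivative
        blinfun_apply (Blinfun (heat_op ?a)) (blinfun_apply (Blinfun (\<lambda>x. (- w) *\<^sub>C heat_op' ?b x)) x)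
        + blinfun_apply (Blinfun (\<lambda>x. w *\<^sub>C heat_op' ?a x)) (blinfun_apply (Blinfun (heat_op ?b)) x)) (at s)"
      unfolding \<psi>_def .
    moreover have "blinfun_apply (Blinfun (heat_op ?a)) (blinfun_apply (Blinfun (\<lambda>x. (- w) *\<^sub>C heat_op' ?b x)) x)
        + blinfun_apply (Blinfun (\<lambda>x. w *\<^sub>C heat_op' ?a x)) (blinfun_apply (Blinfun (heat_op ?b)) x) = 0"
      unfolding heat_op_blinfun_apply[OF pos(1)[OF s]] heat_op_blinfun_apply[OF pos(2)[OF s]]
        ap[OF lin[OF pos(1)[OF s]]] ap[OF lin[OF pos(2)[OF s]]]
        bounded_clinear_scaleC[OF heat_op_clinear[OF pos(1)[OF s]]] heat_op_heat_op'[OF pos[OF s]]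
      by (simp flip: complex_vector.scale_left_distrib)
    ultimately show ?thesis by (auto intro: has_vector_derivative_at_within)
  qed
  then obtain c where c: "\<And>s. s \<in> {0..<1} \<Longrightarrow> \<psi> s = c"
    by (rule has_vector_derivative_zero_constant[of "{0..<1}", rotated]) auto
  \<comment> \<open>At \<open>s = 1\<close> the second factor would sit at time zero, outside the
    half-plane. The endpoint is therefore approached from the left: the first factor converges in
    operator norm, the second one strongly.\<close>
  define q where "q n = 1 - inverse (real (Suc n))" for n
  have q01: "q n \<in> {0..<1}" for n by (auto simp: q_def field_simps)
  have q: "q \<longlonglongrightarrow> 1"
    unfolding q_def using tendsto_diff[OF tendsto_const LIMSEQ_inverse_real_of_nat, of 1] by simp
  have "(\<lambda>n. \<psi> (q n)) \<longlonglongrightarrow> blinfun_apply (Blinfun (heat_op (z + w))) x"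
    unfolding \<psi>_def
  proof (rule blinfun.tendsto)
    have "isCont (\<lambda>z. Blinfun (heat_op z)) (z + w)"
      by (rule has_derivative_continuous[OF heat_op_blinfun_has_derivative]) (use z w in auto)
    moreover have "(\<lambda>n. z + of_real (q n) * w) \<longlonglongrightarrow> z + of_real 1 * w"
      by (intro tendsto_intros q)
    ultimately show "(\<lambda>n. Blinfun (heat_op (z + of_real (q n) * w))) \<longlonglongrightarrow> Blinfun (heat_op (z + w))"
      by (intro isCont_tendsto_compose[of "z + w" "\<lambda>z. Blinfun (heat_op z)"]) auto
    have "filterlim (\<lambda>n. 1 - q n) (at_right 0) sequentially"
      unfolding filterlim_at q_def using LIMSEQ_inverse_real_of_nat by auto
    from filterlim_compose[OF heat_op_tendsto_ray[OF w] this]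
    have "(\<lambda>n. heat_op (of_real (1 - q n) * w) x) \<longlonglongrightarrow> x" .
    moreover have "blinfun_apply (Blinfun (heat_op (w + of_real (q n) * (- w)))) x = heat_op (of_real (1 - q n) * w) x" for n
      unfolding heat_op_blinfun_apply[OF pos(2)[OF q01]] by (simp add: algebra_simps)
    ultimately show "(\<lambda>n. blinfun_apply (Blinfun (heat_op (w + of_real (q n) * (- w)))) x) \<longlonglongrightarrow> x"
      by simp
  qed
  then have "(\<lambda>n. c) \<longlonglongrightarrow> heat_op (z + w) x"
    using c[OF q01] z w by (simp add: heat_op_blinfun_apply)
  then have "c = heat_op (z + w) x" by (simp add: LIMSEQ_const_iff)
  moreover have "\<psi> 0 = heat_op z (heat_op w x)" using z w by (simp add: \<psi>_def heat_op_blinfun_apply)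
  ultimately show ?thesis using c[of 0] by simp
qed

section \<open>The generator of the Gaussian semigroup\<close>

lemma heat_op_has_vector_derivative:
  assumes "t > 0"
  shows "((\<lambda>t. heat_op (of_real t) x) has_vector_derivative heat_op' (of_real t) x) (at t)"
proof -
  have pos: "Re (0 + of_real t * 1) > 0" and pos': "Re (of_real t) > 0" using assms by simp_all
  have "((\<lambda>t. blinfun_apply (Blinfun (heat_op (0 + of_real t * 1))) x) has_vector_derivative
      blinfun_apply (Blinfun (\<lambda>x. 1 *\<^sub>C heat_op' (0 + of_real t * 1) x)) x) (at t)"
    by (rule bounded_linear.has_vector_derivative[OF blinfun.bounded_linear_left
          heat_op_blinfun_has_vector_derivative[OF pos]])
  then have "((\<lambda>t. blinfun_apply (Blinfun (heat_op (of_real t))) x) has_vector_derivative heat_op' (of_real t) x) (at t)"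
    by (simp only: scaleC_one add_0 mult_1_right
        bounded_linear_Blinfun_apply[OF bounded_clinear_linear[OF heat_op'_clinear[OF pos']]])
  then show ?thesis
    by (rule has_vector_derivative_transform_within_open[of _ _ _ "{0<..}"])
      (use assms in \<open>auto simp: heat_op_blinfun_apply\<close>)
qed

text \<open>At positive times the derivative is \<open>heat_op t y\<close>, which tends to
  \<open>y\<close>. The mean value estimate is made on intervals from \<open>r\<close> to
  \<open>t\<close> with \<open>r > 0\<close>, where the derivative is known, and \<open>r\<close>
  tends to zero by strong continuity.\<close>

lemma heat_op_generator_extends:
  assumes "gen x a" "gen a y"
  shows "((\<lambda>h. (1 / h) *\<^sub>R (heat_op (of_real h) x - x)) \<longlongrightarrow> y) (at_right 0)"
proof (rule tendstoI)
  fix e :: real assume e: "e > 0"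
  have lim: "((\<lambda>t. heat_op (of_real t) u) \<longlongrightarrow> u) (at_right 0)" for u
    using heat_op_tendsto_ray[of 1 u] by simp
  have "\<forall>\<^sub>F t in at_right 0. dist (heat_op (of_real t) y) y < e / 2"
    using e by (intro tendstoD[OF lim]) auto
  then obtain d where d: "d > 0" "\<And>t. 0 < t \<Longrightarrow> t < d \<Longrightarrow> norm (heat_op (of_real t) y - y) < e / 2"
    by (auto simp: eventually_at dist_norm)
  have "norm (heat_op (of_real t) x - x - t *\<^sub>R y) \<le> e / 2 * t" if t: "0 < t" "t < d" for t
  proof -
    have "norm ((heat_op (of_real t) x - t *\<^sub>R y) - (heat_op (of_real r) x - r *\<^sub>R y)) \<le> e / 2 * norm (t - r)"
      if r: "r \<in> {0<..<t}" for r
    proof (rule differentiable_bound)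
      fix s assume s: "s \<in> {r..t}"
      then have s0: "s > 0" "s < d" using r t by auto
      have "((\<lambda>s. s *\<^sub>R y) has_vector_derivative y) (at s)"
        unfolding has_vector_derivative_def
        by (rule bounded_linear_imp_has_derivative[OF bounded_linear_scaleR_left])
      from has_vector_derivative_diff[OF heat_op_has_vector_derivative[OF s0(1)] this]
      show "((\<lambda>s. heat_op (of_real s) x - s *\<^sub>R y) has_derivative (\<lambda>h. h *\<^sub>R (heat_op' (of_real s) x - y))) (at s within {r..t})"
        unfolding has_vector_derivative_def by (rule has_derivative_at_withinI)
      show "onorm (\<lambda>h. h *\<^sub>R (heat_op' (of_real s) x - y)) \<le> e / 2"
      proof (rule onorm_le)
        have "heat_op' (of_real s) x = heat_op (of_real s) y" using s0 by (intro gen2_imp_heat_op'[OF _ assms]) simp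
        then have "norm (heat_op' (of_real s) x - y) \<le> e / 2" using d(2)[OF s0] by simp
        then show "norm (h *\<^sub>R (heat_op' (of_real s) x - y)) \<le> e / 2 * norm h" for h
          by (simp add: mult.commute[of "e / 2"] mult_left_mono del: times_divide_eq_left times_divide_eq_right)
      qed
    qed (use r in auto)
    then have ev: "\<forall>\<^sub>F r in at_right 0. norm ((heat_op (of_real t) x - t *\<^sub>R y) - (heat_op (of_real r) x - r *\<^sub>R y)) \<le> e / 2 * norm (t - r)"
      using t by (auto simp: eventually_at intro!: exI[of _ t])
    have "norm ((heat_op (of_real t) x - t *\<^sub>R y) - (x - 0 *\<^sub>R y)) \<le> e / 2 * norm (t - 0)"
    proof (rule tendsto_le[OF _ _ _ ev])
      show "((\<lambda>r. norm ((heat_op (of_real t) x - t *\<^sub>R y) - (heat_op (of_real r) x - r *\<^sub>R y)))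
          \<longlongrightarrow> norm ((heat_op (of_real t) x - t *\<^sub>R y) - (x - 0 *\<^sub>R y))) (at_right 0)"
        by (intro tendsto_intros lim)
      show "((\<lambda>r. e / 2 * norm (t - r)) \<longlongrightarrow> e / 2 * norm (t - 0)) (at_right 0)"
        by (intro tendsto_intros)
    qed simp
    then show ?thesis using t by (simp add: algebra_simps)
  qed
  note est = this
  show "\<forall>\<^sub>F h in at_right 0. dist ((1 / h) *\<^sub>R (heat_op (of_real h) x - x)) y < e"
    unfolding eventually_at
  proof (intro exI[of _ d] conjI ballI impI)
    fix h :: real assume "h \<in> {0<..}" "h \<noteq> 0 \<and> dist h 0 < d"
    then have h: "0 < h" "h < d" by auto
    have "(1 / h) *\<^sub>R (heat_op (of_real h) x - x) - y = (1 / h) *\<^sub>R (heat_op (of_real h) x - x - h *\<^sub>R y)"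
      using h by (simp add: scaleR_diff_right)
    then have "norm ((1 / h) *\<^sub>R (heat_op (of_real h) x - x) - y) = norm (heat_op (of_real h) x - x - h *\<^sub>R y) / h"
      using h by simp
    also have "\<dots> \<le> e / 2" using est[OF h] h by (simp add: field_simps)
    finally show "dist ((1 / h) *\<^sub>R (heat_op (of_real h) x - x)) y < e" using e by (simp add: dist_norm)
  qed (rule d(1))
qed

text \<open>Smoothing carries the derivative at zero to positive times, where the squared generator
  maps \<open>heat_op t x\<close> to \<open>heat_op t y\<close>. Letting \<open>t\<close> tend to
  zero uses that the square is closed.\<close>

lemma heat_op_generator_restricts:
  assumes "((\<lambda>h. (1 / h) *\<^sub>R (heat_op (of_real h) x - x)) \<longlongrightarrow> y) (at_right 0)"
  obtains a where "gen x a" "gen a y"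
proof -
  \<comment> \<open>The right derivative of the orbit at \<open>t\<close> is computed twice:
    directly, and through the semigroup law from the assumed limit at zero.\<close>
  have eq: "heat_op' (of_real t) x = heat_op (of_real t) y" if t: "t > 0" for t
  proof (rule tendsto_unique)
    have cl: "bounded_linear (heat_op (of_real t))"
      using t by (intro bounded_clinear_linear heat_op_clinear) simp
    have "((\<lambda>h. norm (heat_op (of_real (t + h)) x - heat_op (of_real t) x - h *\<^sub>R heat_op' (of_real t) x) / norm h) \<longlongrightarrow> 0) (at_right 0)"
      using heat_op_has_vector_derivative[OF t, of x]
      unfolding has_vector_derivative_def has_derivative_at
      by (auto intro: filterlim_at_split[THEN iffD1, THEN conjunct2])
    moreover have "\<forall>\<^sub>F h in at_right 0. norm (heat_op (of_real (t + h)) x - heat_op (of_real t) x - h *\<^sub>R heat_op' (of_real t) x) / norm h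
        = norm (heat_op (of_real t) ((1 / h) *\<^sub>R (heat_op (of_real h) x - x)) - heat_op' (of_real t) x)"
      unfolding eventually_at_filter
    proof (rule always_eventually, intro allI impI)
      fix h :: real assume "h \<noteq> 0" "h \<in> {0<..}"
      then have h: "h > 0" by simp
      have "heat_op (of_real t) ((1 / h) *\<^sub>R (heat_op (of_real h) x - x)) - heat_op' (of_real t) x
          = (1 / h) *\<^sub>R (heat_op (of_real (t + h)) x - heat_op (of_real t) x - h *\<^sub>R heat_op' (of_real t) x)"
        using h t heat_op_add[of "of_real t" "of_real h" x]
        by (simp add: linear_scale[OF bounded_linear.linear[OF cl]] linear_diff[OF bounded_linear.linear[OF cl]]
            scaleR_diff_right)
      then show "norm (heat_op (of_real (t + h)) x - heat_op (of_real t) x - h *\<^sub>R heat_op' (of_real t) x) / norm h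
        = norm (heat_op (of_real t) ((1 / h) *\<^sub>R (heat_op (of_real h) x - x)) - heat_op' (of_real t) x)"
        using h by simp
    qed
    ultimately have "((\<lambda>h. norm (heat_op (of_real t) ((1 / h) *\<^sub>R (heat_op (of_real h) x - x)) - heat_op' (of_real t) x)) \<longlongrightarrow> 0) (at_right 0)"
      by (rule Lim_transform_eventually)
    then show "((\<lambda>h. heat_op (of_real t) ((1 / h) *\<^sub>R (heat_op (of_real h) x - x))) \<longlongrightarrow> heat_op' (of_real t) x) (at_right 0)"
      by (rule LIM_zero_cancel[OF tendsto_norm_zero_cancel])
    show "((\<lambda>h. heat_op (of_real t) ((1 / h) *\<^sub>R (heat_op (of_real h) x - x))) \<longlongrightarrow> heat_op (of_real t) y) (at_right 0)"
      by (rule bounded_linear.tendsto[OF cl assms])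
  qed simp
  define r :: "nat \<Rightarrow> complex" where "r n = of_real (inverse (real (Suc n)))" for n
  have r: "Re (r n) > 0" for n by (simp add: r_def)
  have lim: "(\<lambda>n. heat_op (r n) u) \<longlonglongrightarrow> u" for u
    unfolding r_def by (rule heat_op_tendsto_sequence)
  have "\<exists>a. gen (heat_op (r n) x) a \<and> gen a (heat_op (r n) y)" for n
  proof -
    have "heat_op' (r n) x = heat_op (r n) y" unfolding r_def by (rule eq) simp
    then show ?thesis by (metis gen_heat_op[OF r])
  qed
  then obtain a where "\<And>n. gen (heat_op (r n) x) (a n)" "\<And>n. gen (a n) (heat_op (r n) y)" by metis
  from gen2_closed[OF this lim lim] that show thesis by blast
qed

lemma gen_dense:
  obtains u where "u \<longlonglongrightarrow> x" "\<And>n. \<exists>y. gen (u n) y"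
proof
  show "(\<lambda>n. heat_op (of_real (inverse (real (Suc n)))) x) \<longlonglongrightarrow> x" by (rule heat_op_tendsto_sequence)
  show "\<exists>y. gen (heat_op (of_real (inverse (real (Suc n)))) x) y" for n
    by (rule gen_heat_op[of "of_real (inverse (real (Suc n)))" x]) auto
qed

end

section \<open>Uniqueness of the generated group\<close>

text \<open>For \<open>u\<close> in the domain, \<open>W (- s) (U s u)\<close> has derivative zero
  in \<open>s\<close>, so it stays equal to \<open>u\<close>; density of the domain and boundedness
  extend the equality to all vectors.\<close>

lemma C0_group_bounded_unique:
  assumes "C0_group_bounded U M \<omega>" "C0_group_bounded W N \<eta>"
    and ext: "\<And>x y. C0_group_bounded.gen U x y \<Longrightarrow> C0_group_bounded.gen W x y"
  shows "U t x = W t x"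
proof -
  interpret U: C0_group_bounded U M \<omega> by fact
  interpret W: C0_group_bounded W N \<eta> by fact
  have inv: "W s (W (- s) y) = y" "W (- s) (W s y) = y" for s y
    using W.add[of s "- s" y] W.add[of "- s" s y] by simp_all
  have dom: "U t u = W t u" if gen: "U.gen u v" for u v
  proof -
    define p where "p s = W (- s) (U s u)" for s
    have "(p has_vector_derivative 0) (at s within UNIV)" for s
    proof -
      \<comment> \<open>The difference of the two difference quotients at \<open>U s u\<close>,
        which vanishes in the limit because the generators agree there. The increment of
        \<open>p\<close> is \<open>W (- s) (W (- h) (h *\<^sub>R d h))\<close>, so uniform bounds on
        \<open>W\<close> replace a product rule.\<close>
      define d where "d h = (1 / h) *\<^sub>R (U h (U s u) - U s u) - (1 / h) *\<^sub>R (W h (U s u) - U s u)" for h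
      define C where "C = N * exp (\<eta> * \<bar>s\<bar>) * (N * exp \<eta>)"
      have "U.gen (U s u) (U s v)" by (rule U.gen_U[OF gen])
      from tendsto_diff[OF this[unfolded U.gen_def] ext[OF this, unfolded W.gen_def]]
      have "(d \<longlongrightarrow> 0) (at 0)" unfolding d_def by simp
      then have lim: "((\<lambda>h. C * norm (d h)) \<longlongrightarrow> 0) (at 0)"
        by (intro tendsto_mult_right_zero tendsto_norm_zero)
      have "((\<lambda>h. norm (p (s + h) - p s - h *\<^sub>R 0) / norm h) \<longlongrightarrow> 0) (at 0)"
      proof (rule Lim_null_comparison[OF _ lim])
        show "\<forall>\<^sub>F h in at 0. norm (norm (p (s + h) - p s - h *\<^sub>R 0) / norm h) \<le> C * norm (d h)"
          unfolding eventually_at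
        proof (intro exI[of _ 1] conjI ballI impI)
          fix h :: real assume h: "h \<noteq> 0 \<and> dist h 0 < 1"
          have hd: "h *\<^sub>R d h = U h (U s u) - W h (U s u)" using h by (simp add: d_def scaleR_diff_right)
          have "p (s + h) = W (- s) (W (- h) (U h (U s u)))"
            using W.add[of "- s" "- h"] U.add[of h s u] by (simp add: p_def add.commute)
          moreover have "p s = W (- s) (W (- h) (W h (U s u)))" by (simp add: p_def inv)
          ultimately have "p (s + h) - p s = W (- s) (W (- h) (h *\<^sub>R d h))"
            by (simp add: hd W.U_diff)
          then have "norm (p (s + h) - p s) \<le> N * exp (\<eta> * \<bar>s\<bar>) * norm (W (- h) (h *\<^sub>R d h))"
            using W.bound[of "- s" "W (- h) (h *\<^sub>R d h)"] by simp
          also have "\<dots> \<le> N * exp (\<eta> * \<bar>s\<bar>) * (N * exp \<eta> * norm (h *\<^sub>R d h))"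
            using h W.M_ge_1 by (intro mult_left_mono W.U_uniform_bound) auto
          also have "\<dots> = \<bar>h\<bar> * (C * norm (d h))" by (simp add: C_def)
          finally show "norm (norm (p (s + h) - p s - h *\<^sub>R 0) / norm h) \<le> C * norm (d h)"
            using h by (simp add: field_simps)
        qed simp
      qed
      then show ?thesis
        unfolding has_vector_derivative_def
        by (intro has_derivative_at[THEN iffD2] conjI bounded_linear_scaleR_left)
    qed
    then obtain c where c: "\<And>s. p s = c"
      by (rule has_vector_derivative_zero_constant[of UNIV, rotated]) auto
    have "p t = u" using c[of t] c[of 0] by (simp add: p_def)
    then show "U t u = W t u" unfolding p_def by (metis inv(1))
  qed
  obtain u where u: "u \<longlonglongrightarrow> x" "\<And>n. \<exists>y. U.gen (u n) y" by (rule U.gen_dense) blast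
  have "U t (u n) = W t (u n)" for n using u(2)[of n] dom by blast
  then have "(\<lambda>n. U t (u n)) \<longlonglongrightarrow> W t x"
    using bounded_linear.tendsto[OF W.linear_U u(1), of t] by simp
  then show ?thesis
    using bounded_linear.tendsto[OF U.linear_U u(1), of t] LIMSEQ_unique by blast
qed

context C0_group_bounded
begin

lemma gen_iff_generator_at:
  "generator_at (at 0) U D B \<Longrightarrow> gen x y \<longleftrightarrow> x \<in> D \<and> B x = y"
  unfolding generator_at_def gen_def[symmetric] using gen_unique by blast

lemma heat_op_generator_iff:
  assumes "generator_at (at 0) U D B"
  shows "((\<lambda>h. (1 / h) *\<^sub>R (heat_op (of_real h) x - x)) \<longlongrightarrow> y) (at_right 0)
    \<longleftrightarrow> x \<in> D \<and> B x \<in> D \<and> B (B x) = y"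
  using heat_op_generator_extends[of x _ y] heat_op_generator_restricts[of x y]
  by (auto simp: gen_iff_generator_at[OF assms])

end

lemma generator_atI:
  assumes "F \<noteq> bot"
    and "\<And>x y. ((\<lambda>h. (1 / h) *\<^sub>R (T h x - x)) \<longlongrightarrow> y) F \<longleftrightarrow> x \<in> D \<and> A x = y"
  shows "generator_at F T D A"
  using assms by (auto simp: generator_at_def)

lemma linear_operator_neg:
  "linear_operator D A \<Longrightarrow> x \<in> D \<Longrightarrow> - x \<in> D \<and> A (- x) = - A x"
  unfolding linear_operator_def
  by (metis complex_vector.subspace_neg complex_vector.scale_minus_left scaleC_one)

lemma linear_operator_zero:
  "linear_operator D A \<Longrightarrow> 0 \<in> D \<and> A 0 = 0"
  unfolding linear_operator_def
  by (metis complex_vector.subspace_0 complex_vector.scale_zero_left)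

section \<open>Block operators\<close>

definition flip :: "'a::complex_banach \<times> 'b::complex_banach \<Rightarrow> 'a \<times> 'b" where
  "flip p = (fst p, - snd p)"

lemma flip_simps [simp]: "flip (x, y) = (x, - y)" "flip (flip p) = p" "norm (flip p) = norm p"
  by (simp_all add: flip_def norm_prod_def)

lemma bounded_clinear_flip: "bounded_clinear flip"
  unfolding bounded_clinear_def flip_def
  by (simp add: scaleC_prod_def bounded_linear_Pair bounded_linear_fst bounded_linear_minus bounded_linear_snd)

text \<open>Reversing time and conjugating by \<open>flip\<close> negates the generator and changes
  the sign of its off-diagonal entries. The two signs cancel, so the new group has the old generator
  and coincides with the old group.\<close>

lemma block_group_flip:
  fixes D12 :: "'b::complex_banach set" and A12 :: "'b \<Rightarrow> 'a::complex_banach"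
  assumes "linear_operator D12 A12" "linear_operator D21 A21"
    and bdd: "C0_group_bounded U M \<omega>"
    and gen: "generator_at (at 0) U {(x1, x2). x1 \<in> D21 \<and> x2 \<in> D12} (\<lambda>(x1, x2). (A12 x2, A21 x1))"
  shows "flip (U t p) = U (- t) (flip p)"
proof -
  interpret C0_group_bounded U M \<omega> by fact
  note fl = bounded_clinear_linear[OF bounded_clinear_flip]
  define W where "W t p = flip (U (- t) (flip p))" for t p
  have W: "C0_group_bounded W M \<omega>"
  proof
    show "bounded_clinear (W t)" for t
      unfolding bounded_clinear_def W_def
      by (auto intro!: bounded_linear_compose[OF fl] bounded_linear_compose[OF linear_U] fl
          simp: bounded_clinear_scaleC[OF bounded_clinear_flip] bounded_clinear_scaleC[OF clinear])
    show "W (s + t) p = W s (W t p)" for s t p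
      using add[of "- s" "- t"] by (simp add: W_def)
    show "continuous_on UNIV (\<lambda>t. W t p)" for p
      unfolding W_def
      by (intro bounded_linear.continuous_on[OF fl] continuous_on_compose2[OF cont continuous_on_minus]
          continuous_on_id subset_UNIV)
    show "norm (W t p) \<le> M * exp (\<omega> * \<bar>t\<bar>) * norm p" for t p
      using bound[of "- t" "flip p"] by (simp add: W_def)
  qed (use omega_nonneg M_ge_1 in \<open>simp_all add: W_def\<close>)
  interpret W: C0_group_bounded W M \<omega> by fact
  have "W.gen p y" if "gen p y" for p y
  proof -
    obtain x1 x2 where p: "p = (x1, x2)" by force
    have x: "x1 \<in> D21" "x2 \<in> D12" "y = (A12 x2, A21 x1)"
      using that p by (auto simp: gen_iff_generator_at[OF gen])
    \<comment> \<open>Anticommutation: only off-diagonal entries occur, so a sign on the second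
      input becomes a sign on the first output.\<close>
    then have "gen (flip p) (- flip y)"
      using assms(1,2) p by (simp add: gen_iff_generator_at[OF gen] linear_operator_neg)
    moreover have "filterlim uminus (at 0) (at (0::real))"
      by (simp add: filterlim_def filtermap_at_minus)
    ultimately have "((\<lambda>h. (1 / - h) *\<^sub>R (U (- h) (flip p) - flip p)) \<longlongrightarrow> - flip y) (at 0)"
      unfolding gen_def by (rule filterlim_compose)
    from tendsto_minus[OF bounded_linear.tendsto[OF fl this]]
    have "((\<lambda>h. - flip ((1 / - h) *\<^sub>R (U (- h) (flip p) - flip p))) \<longlongrightarrow> y) (at 0)"
      by (simp add: linear_neg[OF bounded_linear.linear[OF fl]])
    then show ?thesis
      unfolding W.gen_def W_def
      by (simp add: linear_neg[OF bounded_linear.linear[OF fl]] linear_diff[OF bounded_linear.linear[OF fl]]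
          linear_scale[OF bounded_linear.linear[OF fl]])
  qed
  from C0_group_bounded_unique[OF bdd W this, of t p] show ?thesis
    by (simp add: W_def)
qed

lemma bounded_clinear_compose:
  "bounded_clinear f \<Longrightarrow> bounded_clinear g \<Longrightarrow> bounded_clinear (\<lambda>x. f (g x))"
  by (simp add: bounded_clinear_def bounded_linear_compose)

lemma bounded_clinear_fst: "bounded_clinear (fst :: 'a::complex_normed_vector \<times> 'b::complex_normed_vector \<Rightarrow> 'a)"
  by (simp add: bounded_clinear_def bounded_linear_fst scaleC_prod_def)

lemma bounded_clinear_Pair_zero:
  "bounded_clinear (\<lambda>x::'a::complex_normed_vector. (x, 0 :: 'b::complex_normed_vector))"
  by (simp add: bounded_clinear_def scaleC_prod_def bounded_linear_Pair bounded_linear_ident bounded_linear_zero)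

theorem theorem2p3:
  fixes D12 :: "'b::complex_banach set" and A12 :: "'b \<Rightarrow> 'a::complex_banach"
    and D21 :: "'a set" and A21 :: "'a \<Rightarrow> 'b"
    and S :: "'b \<Rightarrow> 'b"
  assumes "linear_operator D12 A12"
    and "linear_operator D21 A21"
    and "generates_contraction_C0_semigroup
           {(x1, x2). x1 \<in> D21 \<and> x2 \<in> D12} (A_ext A12 A21)"
    and "bounded_clinear S"
    and "generates_C0_group
           {(x1, x2). x1 \<in> D21 \<and> x2 \<in> D12} (diag_I S \<circ> A_ext A12 A21)"
  shows "generates_analytic_semigroup (pi / 2)
           {x. x \<in> D21 \<and> S (A21 x) \<in> D12} (A12 \<circ> S \<circ> A21)"
proof -
  let ?D = "{(x1, x2). x1 \<in> D21 \<and> x2 \<in> D12}" and ?B = "\<lambda>(x1, x2). (A12 x2, (S \<circ> A21) x1)"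
  \<comment> \<open>\<open>S\<close> is absorbed into the lower left entry, which leaves an
    off-diagonal block operator with entries \<open>A12\<close> and
    \<open>S \<circ> A21\<close>.\<close>
  have "diag_I S \<circ> A_ext A12 A21 = ?B"
    by (auto simp: diag_I_def A_ext_def)
  then obtain U where U: "C0_group U" "generator_at (at 0) U ?D ?B"
    using assms(5) unfolding generates_C0_group_def by auto
  obtain M \<omega> where bdd: "C0_group_bounded U M \<omega>" using C0_group_bounded_exists[OF U(1)] by blast
  interpret C0_group_bounded U M \<omega> by fact
  have SA: "linear_operator D21 (S \<circ> A21)"
    using assms(2,4) linear_add[OF bounded_linear.linear[OF bounded_clinear_linear[OF assms(4)]]]
    by (simp add: linear_operator_def bounded_clinear_scaleC)
  \<comment> \<open>Zero needs its own case: there the kernel divides by zero and the average would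
    be the zero operator instead of the identity.\<close>
  define T where "T z x = (if z = 0 then x else fst (heat_op z (x, 0)))" for z x
  have VT: "heat_op z (x, 0) = (T z x, 0)" if z: "Re z > 0" for z x
  proof -
    obtain c where "admissible (\<lambda>s. heat z (of_real s)) c" by (rule heat_admissible[OF z])
    then have "flip (heat_op z (x, 0)) = heat_op z (flip (x, 0))"
      unfolding heat_op_def
      by (rule Phi_even[OF _ _ bounded_clinear_flip block_group_flip[OF assms(1) SA bdd U(2)]])
        (simp add: heat_even)
    then have "- snd (heat_op z (x, 0)) = snd (heat_op z (x, 0))" by (simp add: flip_def prod_eq_iff)
    then have "2 *\<^sub>R snd (heat_op z (x, 0)) = 0" by (simp add: scaleR_2 neg_eq_iff_add_eq_0)
    then have "snd (heat_op z (x, 0)) = 0" by simp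
    then show ?thesis using z by (auto simp: T_def prod_eq_iff)
  qed
  have T: "T z = (\<lambda>x. fst (heat_op z (x, 0)))" if "Re z > 0" for z
    using that by (auto simp: T_def fun_eq_iff)
  have comp: "bounded_clinear (\<lambda>x. fst (G (x, 0)))" if "bounded_clinear G" for G :: "'a \<times> 'b \<Rightarrow> 'a \<times> 'b"
    by (intro bounded_clinear_compose[OF bounded_clinear_fst]
        bounded_clinear_compose[OF that bounded_clinear_Pair_zero])
  have "analytic_semigroup (pi / 2) T"
    unfolding analytic_semigroup_def sector_half_plane
  proof (intro conjI ballI allI impI)
    show T0: "T 0 = id" by (auto simp: T_def fun_eq_iff)
    show "bounded_clinear (T z)" if "z \<in> {z. Re z > 0} \<union> {0}" for z
    proof (cases "z = 0")
      case False
      then show ?thesis using that by (auto simp: T intro: comp heat_op_clinear)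
    qed (simp add: T0 bounded_clinear_def id_def bounded_linear_ident)
    show "T (z + w) = T z \<circ> T w" if "z \<in> {z. Re z > 0}" "w \<in> {z. Re z > 0}" for z w
    proof
      fix x
      have "heat_op (z + w) (x, 0) = heat_op z (heat_op w (x, 0))" using that by (intro heat_op_add) auto
      then show "T (z + w) x = (T z \<circ> T w) x" using that by (simp add: VT)
    qed
    show "operator_analytic_on T {z. Re z > 0}"
      unfolding operator_analytic_on_def
    proof
      fix z assume "z \<in> {z. Re z > 0}"
      then have z: "Re z > 0" by simp
      obtain L where L: "bounded_clinear L"
        "((\<lambda>w. onorm (\<lambda>x. (1 / (w - z)) *\<^sub>C (heat_op w x - heat_op z x) - L x)) \<longlongrightarrow> 0) (at z)"
        using heat_op_operator_analytic z unfolding operator_analytic_on_def by blast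
      have "((\<lambda>w. onorm (\<lambda>x. (1 / (w - z)) *\<^sub>C (T w x - T z x) - fst (L (x, 0)))) \<longlongrightarrow> 0) (at z)"
      \<comment> \<open>\<open>T\<close> is a compression of \<open>heat_op\<close>: the embedding
        is isometric and the projection contractive, so operator norms do not grow.\<close>
      proof (rule Lim_null_comparison[OF _ L(2)])
        have "\<forall>\<^sub>F w in at z. w \<in> {z. Re z > 0}"
          using z by (intro eventually_at_in_open' open_halfspace_Re_gt) auto
        then show "\<forall>\<^sub>F w in at z. norm (onorm (\<lambda>x. (1 / (w - z)) *\<^sub>C (T w x - T z x) - fst (L (x, 0))))
            \<le> onorm (\<lambda>x. (1 / (w - z)) *\<^sub>C (heat_op w x - heat_op z x) - L x)"
        proof eventually_elim
          case (elim w)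
          then have w: "Re w > 0" by simp
          define G where "G p = (1 / (w - z)) *\<^sub>C (heat_op w p - heat_op z p) - L p" for p
          have G: "bounded_linear G"
            unfolding G_def
            by (intro bounded_linear_sub bounded_linear_compose[OF bounded_clinear_linear[OF bounded_clinear_scaleC_right]]
                bounded_clinear_linear heat_op_clinear z w L)
          have eq: "(1 / (w - z)) *\<^sub>C (T w x - T z x) - fst (L (x, 0)) = fst (G (x, 0))" for x
            by (simp add: T z w G_def scaleC_prod_def)
          have "bounded_linear (\<lambda>x. fst (G (x, 0)))"
            by (intro bounded_linear_compose[OF bounded_linear_fst]
                bounded_linear_compose[OF G bounded_clinear_linear[OF bounded_clinear_Pair_zero]])
          then have "0 \<le> onorm (\<lambda>x. fst (G (x, 0)))" by (rule onorm_pos_le)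
          moreover have "onorm (\<lambda>x. fst (G (x, 0))) \<le> onorm G"
          proof (rule onorm_bound[OF onorm_pos_le[OF G]])
            fix x
            have "norm (fst (G (x, 0))) \<le> norm (G (x, 0))" by (metis norm_fst_le prod.collapse)
            also have "\<dots> \<le> onorm G * norm (x, 0::'b)" by (rule onorm[OF G])
            finally show "norm (fst (G (x, 0))) \<le> onorm G * norm x" by (simp add: norm_Pair)
          qed
          ultimately show ?case unfolding eq G_def[symmetric] by simp
        qed
      qed
      with comp[OF L(1)] show "\<exists>L. bounded_clinear L \<and>
          ((\<lambda>w. onorm (\<lambda>x. (1 / (w - z)) *\<^sub>C (T w x - T z x) - L x)) \<longlongrightarrow> 0) (at z)"
        by blast
    qed
    show "((\<lambda>z. T z x) \<longlongrightarrow> x) (at 0 within sector \<delta>)" if "0 < \<delta> \<and> \<delta> < pi / 2" for \<delta> x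
    proof (rule Lim_transform_eventually)
      show "((\<lambda>z. fst (heat_op z (x, 0))) \<longlongrightarrow> x) (at 0 within sector \<delta>)"
        using tendsto_fst[OF heat_op_tendsto[of \<delta> "(x, 0)"]] that by simp
      show "\<forall>\<^sub>F z in at 0 within sector \<delta>. fst (heat_op z (x, 0)) = T z x"
        by (auto simp: eventually_at_filter T_def)
    qed
  qed
  moreover have "generator_at (at_right 0) (\<lambda>t. T (of_real t))
      {x. x \<in> D21 \<and> S (A21 x) \<in> D12} (A12 \<circ> S \<circ> A21)"
  proof (rule generator_atI)
    fix x y
    have "\<forall>\<^sub>F h in at_right 0. (1 / h) *\<^sub>R (heat_op (of_real h) (x, 0) - (x, 0)) = ((1 / h) *\<^sub>R (T (of_real h) x - x), 0)"
      by (auto simp: eventually_at_filter VT)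
    then have "((\<lambda>h. (1 / h) *\<^sub>R (heat_op (of_real h) (x, 0) - (x, 0))) \<longlongrightarrow> (y, 0)) (at_right 0)
        \<longleftrightarrow> ((\<lambda>h. ((1 / h) *\<^sub>R (T (of_real h) x - x), 0 :: 'b)) \<longlongrightarrow> (y, 0)) (at_right 0)"
      by (rule tendsto_cong)
    also have "\<dots> \<longleftrightarrow> ((\<lambda>h. (1 / h) *\<^sub>R (T (of_real h) x - x)) \<longlongrightarrow> y) (at_right 0)"
      by (auto dest: tendsto_fst intro: tendsto_Pair)
    finally show "((\<lambda>h. (1 / h) *\<^sub>R (T (of_real h) x - x)) \<longlongrightarrow> y) (at_right 0)
        \<longleftrightarrow> x \<in> {x. x \<in> D21 \<and> S (A21 x) \<in> D12} \<and> (A12 \<circ> S \<circ> A21) x = y"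
      \<comment> \<open>At \<open>(x, 0)\<close> the block operator gives
        \<open>(A12 0, S (A21 x))\<close> with \<open>A12 0 = 0\<close>, so its square exists iff
        \<open>x\<close> lies in the claimed domain. The second component of the square is
        \<open>S (A21 0) = 0\<close>.\<close>
      unfolding heat_op_generator_iff[OF U(2)]
      using linear_operator_zero[OF assms(1)] linear_operator_zero[OF SA] linear_operator_zero[OF assms(2)]
      by auto
  qed simp
  ultimately show ?thesis unfolding generates_analytic_semigroup_def by blast
qed

end
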